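(* All histories admitted by the snapshot-memory algorithm described in the context, executed in the asynchronous crash-prone message-passing model described in the context (fewer than $n/2$ processes may crash), are sequentially consistent with respect to the sequential specification of the snapshot memory.
   Context: **Model.** There are $n$ sequential asynchronous processes $p_0,\dots,p_{n-1}$ (no bound on speed). Fewer than $n/2$ of them may crash (halt prematurely); a process that crashes is faulty, otherwise it is correct. Every ordered pair of processes (including a process and itself) is connected by a channel that is reliable (no loss, creation, duplication, alteration), asynchronous (finite but unbounded transit time), and FIFO. The receiver can identify the sender. A process receives its own messages instantaneously: a message to itself is handled right after the piece of code that sent it, before any other step of that process. "FIFO broadcast $m$" sends $m$ to all processes including the sender; if the sender crashes during the broadcast, some processes may receive $m$ and others not; otherwise all correct processes eventually receive it. Each operation body and each message handler is executed atomically on its process, except that message handlers run while a process is waiting. **Snapshot memory.** An array of registers $REG$ with one entry per process, with initial value $0$ and values in $\mathbb{N}$. $update(v)$ invoked by $p_i$ writes $v$ in $REG[i]$; $snapshot()$ returns an array containing the most recent value written by each process (the initial value if none). The sequential specification is the set of words of operations (each tagged by its invoking process) in which each snapshot returns, for each process, the value of the last preceding update by that process, or $0$. **Sequential consistency.** A history contains a set of operations, partially ordered by the process order (the sequential order of each process). It models an execution: it contains all returned operations and only invoked operations (an operation interrupted by a crash may appear as complete or not at all). A history $H$ is sequentially consistent for a specification $T$ if there is a total order $\le$ on its operations that contains the process order, such that each operation $e$ has a finite past $\{e' : e'\le e\}$, and such that the word of all operations of $H$ ordered by $\le$ belongs to $T$. **Algorithm (code for $p_i$).** Local variables: $X_i\in\mathbb{N}^n$,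 initially all $0$ (last validated values); $ValClock_i\in\mathbb{N}^n$, initially all $0$ (stamps of these values); $SendClock_i\in\mathbb{N}$, initially $0$; $G_i$, initially $\emptyset$, a set of records $g=(g.v,g.k,g.t,g.cl)$ with $g.v,g.k,g.t\in\mathbb{N}$ and $g.cl\in(\mathbb{N}\cup\{\infty\})^n$ (one record per non-validated update of value $g.v$ by $p_{g.k}$ with stamp $g.t$); $V_i\in\mathbb{N}\cup\{\bot\}$, initially $\bot$ (postponed update). Operation $update(v)$: if every $g\in G_i$ has $g.k\ne i$, then increment $SendClock_i$ and FIFO broadcast $message(v,i,SendClock_i,SendClock_i)$; otherwise set $V_i\leftarrow v$. Then return. Operation $snapshot()$: wait until $V_i=\bot$ and every $g\in G_i$ has $g.k\neq i$; then return $X_i$. When $message(v,k,t,cl)$ is received from $p_j$: (A) If $t>ValClock_i[k]$: if there is $g\in G_i$ with $g.k=k$ and $g.t=t$, set $g.cl[j]\leftarrow cl$; otherwise, first, if $k\ne i$, increment $SendClock_i$ and FIFO broadcast $message(v,k,t,SendClock_i)$, and then add to $G_i$ a new record $g$ with $g.v=v$, $g.k=k$, $g.t=t$, $g.cl=[\infty,\dots,\infty]$ except $g.cl[j]=cl$. (B) Let $G'=\{g\in G_i : |\{l : g.cl[l]<\infty\}|>\frac n2\}$. While there exist $g\in G_i\setminus G'$ and $g'\in G'$ with $|\{l : g'.cl[l]<g.cl[l]\}|\le\frac n2$, remove $g'$ from $G'$. Then set $G_i\leftarrow G_i\setminus G'$, and for each $g\in G'$, if $ValClock_i[g.k]<g.t$,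 set $ValClock_i[g.k]\leftarrow g.t$ and $X_i[g.k]\leftarrow g.v$. (C) If $V_i\ne\bot$ and every $g\in G_i$ has $g.k\ne i$: increment $SendClock_i$, FIFO broadcast $message(V_i,i,SendClock_i,SendClock_i)$, and set $V_i\leftarrow\bot$.
   Formalization: In an infinite history, a returned update that was postponed in V_i by a process which crashes before completing its broadcast in (C) counts as interrupted by the crash and may be absent; with all returned operations required the claim fails. Finite histories contain all returned operations. *)

theory Defs
  imports "HOL-Library.Extended_Nat" "HOL-Library.Cardinality"
begin

section \<open>Histories and sequential consistency\<close>

record ('e, 'a) history =
  events :: "'e set"
  op_of :: "'e \<Rightarrow> 'a"
  process_order :: "'e rel"

text \<open>A finite or infinite word is a partial function on positions whose domain is an
  initial segment of the natural numbers; finite and infinite histories are treated alike.\<close>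

type_synonym 'a word = "nat \<Rightarrow> 'a option"

definition is_word :: "'a word \<Rightarrow> bool" where
  "is_word w \<longleftrightarrow> (\<forall>l m. l \<le> m \<and> w m \<noteq> None \<longrightarrow> w l \<noteq> None)"

definition rank :: "('e, 'a) history \<Rightarrow> 'e rel \<Rightarrow> 'e \<Rightarrow> nat" where
  "rank H R e = card {e' \<in> events H. (e', e) \<in> R \<and> e' \<noteq> e}"

text \<open>Only meaningful when \<open>R\<close> is a linear order on the events in which every event has
  a finite past; the rank is then injective on the events.\<close>

definition word_of :: "('e, 'a) history \<Rightarrow> 'e rel \<Rightarrow> 'a word" where
  "word_of H R m =
     (if \<exists>e \<in> events H. rank H R e = m
      then Some (op_of H (THE e. e \<in> events H \<and> rank H R e = m))
      else None)"

definition sequentially_consistent :: "'a word set \<Rightarrow> ('e, 'a) history \<Rightarrow> bool" where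
  "sequentially_consistent T H \<longleftrightarrow>
     (\<exists>R. linear_order_on (events H) R \<and>
          process_order H \<subseteq> R \<and>
          (\<forall>e \<in> events H. finite {e'. (e', e) \<in> R}) \<and>
          word_of H R \<in> T)"


section \<open>Sequential specification of the snapshot memory\<close>

datatype 'p oper = Update nat | Snapshot "'p \<Rightarrow> nat"

type_synonym 'p tagged = "'p \<times> 'p oper"

text \<open>The value of the last update of \<open>j\<close> at a position below \<open>m\<close>, or 0.\<close>

fun last_written :: "'p tagged word \<Rightarrow> nat \<Rightarrow> 'p \<Rightarrow> nat" where
  "last_written w 0 j = 0"
| "last_written w (Suc m) j =
     (case w m of
        Some (i, Update v) \<Rightarrow> if i = j then v else last_written w m j
      | _ \<Rightarrow> last_written w m j)"

definition snapshot_spec :: "'p tagged word set" where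
  "snapshot_spec =
     {w. is_word w \<and>
         (\<forall>m i a. w m = Some (i, Snapshot a) \<longrightarrow> (\<forall>j. a j = last_written w m j))}"


section \<open>Local code of the algorithm\<close>

text \<open>The processes are the elements of the finite type \<open>'p\<close>; their number is \<open>CARD('p)\<close>.\<close>

record 'p entry =
  e_v :: nat
  e_k :: 'p
  e_t :: nat
  e_cl :: "'p \<Rightarrow> enat"

record 'p lstate =
  l_X :: "'p \<Rightarrow> nat"
  l_ValClock :: "'p \<Rightarrow> nat"
  l_SendClock :: nat
  l_G :: "'p entry set"
  l_V :: "nat option"

datatype 'p message = Message nat 'p nat nat

definition init_lstate :: "'p lstate" where
  "init_lstate =
     \<lparr>l_X = (\<lambda>_. 0), l_ValClock = (\<lambda>_. 0), l_SendClock = 0, l_G = {}, l_V = None\<rparr>"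

definition majority :: "'p::finite set \<Rightarrow> bool" where
  "majority A \<longleftrightarrow> 2 * card A > CARD('p)"

definition no_own :: "'p \<Rightarrow> 'p lstate \<Rightarrow> bool" where
  "no_own i s \<longleftrightarrow> (\<forall>g \<in> l_G s. e_k g \<noteq> i)"

text \<open>A piece of code maps a local state to a new local state and the list of messages it
  broadcasts, in order.\<close>

definition send_own :: "'p \<Rightarrow> nat \<Rightarrow> 'p lstate \<Rightarrow> 'p lstate \<times> 'p message list" where
  "send_own i v s =
     (let c = Suc (l_SendClock s) in (s\<lparr>l_SendClock := c\<rparr>, [Message v i c c]))"

definition update_code :: "'p \<Rightarrow> nat \<Rightarrow> 'p lstate \<Rightarrow> 'p lstate \<times> 'p message list" where
  "update_code i v s = (if no_own i s then send_own i v s else (s\<lparr>l_V := Some v\<rparr>, []))"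

text \<open>The assignment to the field of a record in the set is an image;
  in reachable states at most one record has a given pair \<open>(e_k, e_t)\<close>.\<close>

fun record_code :: "'p \<Rightarrow> 'p \<Rightarrow> 'p message \<Rightarrow> 'p lstate \<Rightarrow> 'p lstate \<times> 'p message list" where
  "record_code i j (Message v k t c) s =
     (if t > l_ValClock s k then
        if \<exists>g \<in> l_G s. e_k g = k \<and> e_t g = t then
          (s\<lparr>l_G := (\<lambda>g. if e_k g = k \<and> e_t g = t
                         then g\<lparr>e_cl := (e_cl g)(j := enat c)\<rparr> else g) ` l_G s\<rparr>, [])
        else
          (let g = \<lparr>e_v = v, e_k = k, e_t = t, e_cl = (\<lambda>_. \<infinity>)(j := enat c)\<rparr>;
               c' = Suc (l_SendClock s);
               (s', ms) = (if k \<noteq> i then (s\<lparr>l_SendClock := c'\<rparr>, [Message v k t c']) else (s, []))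
           in (s'\<lparr>l_G := insert g (l_G s')\<rparr>, ms))
      else (s, []))"

text \<open>The removal loop is kept as a nondeterministic iteration run until it is stuck, and
  the final iteration over the validated records may use any enumeration of them.\<close>

inductive prune_step :: "'p::finite entry set \<Rightarrow> 'p entry set \<Rightarrow> 'p entry set \<Rightarrow> bool"
  for G where
  "g \<in> G - A \<Longrightarrow> g' \<in> A \<Longrightarrow> \<not> majority {l. e_cl g' l < e_cl g l} \<Longrightarrow>
     prune_step G A (A - {g'})"

definition validated :: "'p::finite entry set \<Rightarrow> 'p entry set \<Rightarrow> bool" where
  "validated G A \<longleftrightarrow>
     (prune_step G)\<^sup>*\<^sup>* {g \<in> G. majority {l. e_cl g l < \<infinity>}} A \<and> (\<nexists>B. prune_step G A B)"

definition apply_entry :: "'p entry \<Rightarrow> 'p lstate \<Rightarrow> 'p lstate" where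
  "apply_entry g s =
     (if l_ValClock s (e_k g) < e_t g
      then s\<lparr>l_ValClock := (l_ValClock s)(e_k g := e_t g), l_X := (l_X s)(e_k g := e_v g)\<rparr>
      else s)"

definition validate_code :: "'p::finite lstate \<Rightarrow> 'p lstate \<Rightarrow> bool" where
  "validate_code s s' \<longleftrightarrow>
     (\<exists>gs. distinct gs \<and> validated (l_G s) (set gs) \<and>
           s' = fold apply_entry gs (s\<lparr>l_G := l_G s - set gs\<rparr>))"

definition flush_code :: "'p \<Rightarrow> 'p lstate \<Rightarrow> 'p lstate \<times> 'p message list" where
  "flush_code i s =
     (case l_V s of
        Some v \<Rightarrow> if no_own i s then (let (s', ms) = send_own i v s in (s'\<lparr>l_V := None\<rparr>, ms))
                 else (s, [])
      | None \<Rightarrow> (s, []))"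

definition handler ::
  "'p::finite \<Rightarrow> 'p \<Rightarrow> 'p message \<Rightarrow> 'p lstate \<Rightarrow> 'p lstate \<Rightarrow> 'p message list \<Rightarrow> bool" where
  "handler i j m s s' ms \<longleftrightarrow>
     (\<exists>s1 ms1 s2 ms2. record_code i j m s = (s1, ms1) \<and> validate_code s1 s2 \<and>
        flush_code i s2 = (s', ms2) \<and> ms = ms1 @ ms2)"


section \<open>Asynchronous executions with crashes\<close>

text \<open>\<open>c_chan c i j\<close> is the FIFO channel from \<open>i\<close> to \<open>j\<close>; \<open>c_waiting c\<close> contains the
  processes with a snapshot that is invoked but not returned.\<close>

record 'p config =
  c_local :: "'p \<Rightarrow> 'p lstate"
  c_chan :: "'p \<Rightarrow> 'p \<Rightarrow> 'p message list"
  c_waiting :: "'p set"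
  c_crashed :: "'p set"

definition init_config :: "'p config" where
  "init_config =
     \<lparr>c_local = (\<lambda>_. init_lstate), c_chan = (\<lambda>_ _. []), c_waiting = {}, c_crashed = {}\<rparr>"

text \<open>\<open>Do_Update i v\<close> is the whole body of an update, including its return;
  \<open>Receive i j\<close> is the handling by \<open>i\<close> of a message from \<open>j\<close>. The variants with
  suffix \<open>Crash\<close> are crashes in the middle of such a piece of code.\<close>

datatype 'p action =
    Do_Update 'p nat
  | Do_Update_Crash 'p nat
  | Call_Snapshot 'p
  | Return_Snapshot 'p "'p \<Rightarrow> nat"
  | Receive 'p 'p
  | Receive_Crash 'p 'p
  | Crash 'p
  | Stutter

definition send ::
  "'p \<Rightarrow> ('p \<Rightarrow> 'p message list) \<Rightarrow> ('p \<Rightarrow> 'p \<Rightarrow> 'p message list) \<Rightarrow> 'p \<Rightarrow> 'p \<Rightarrow> 'p message list" where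
  "send i out ch = ch(i := (\<lambda>j. ch i j @ out j))"

text \<open>What a process that crashes while broadcasting \<open>ms\<close> has put on its channels: the first
  \<open>m\<close> messages everywhere, and the next one (if any) to the processes of an arbitrary set.\<close>

definition cut_broadcast :: "'p message list \<Rightarrow> ('p \<Rightarrow> 'p message list) \<Rightarrow> bool" where
  "cut_broadcast ms out \<longleftrightarrow> (\<exists>m D. out = (\<lambda>j. take (if j \<in> D then Suc m else m) ms))"

text \<open>Messages to oneself are handled right after the code that sent them: a process with a
  nonempty channel to itself can take no step except receiving from that channel (or crashing).\<close>

definition free :: "'p config \<Rightarrow> 'p \<Rightarrow> bool" where
  "free c i \<longleftrightarrow> i \<notin> c_crashed c \<and> c_chan c i i = []"

definition can_return :: "'p config \<Rightarrow> 'p \<Rightarrow> bool" where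
  "can_return c i \<longleftrightarrow>
     free c i \<and> i \<in> c_waiting c \<and> l_V (c_local c i) = None \<and> no_own i (c_local c i)"

definition can_receive :: "'p config \<Rightarrow> 'p \<Rightarrow> 'p \<Rightarrow> bool" where
  "can_receive c i j \<longleftrightarrow> i \<notin> c_crashed c \<and> c_chan c j i \<noteq> [] \<and> (j = i \<or> c_chan c i i = [])"

definition pop :: "'p \<Rightarrow> 'p \<Rightarrow> ('p \<Rightarrow> 'p \<Rightarrow> 'p message list) \<Rightarrow> 'p \<Rightarrow> 'p \<Rightarrow> 'p message list" where
  "pop i j ch = ch(j := (ch j)(i := tl (ch j i)))"

inductive step :: "'p::finite config \<Rightarrow> 'p action \<Rightarrow> 'p config \<Rightarrow> bool" where
  update:
  "free c i \<Longrightarrow> i \<notin> c_waiting c \<Longrightarrow> update_code i v (c_local c i) = (s, ms) \<Longrightarrow>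
     step c (Do_Update i v)
       (c\<lparr>c_local := (c_local c)(i := s), c_chan := send i (\<lambda>_. ms) (c_chan c)\<rparr>)"
| update_crash:
  "free c i \<Longrightarrow> i \<notin> c_waiting c \<Longrightarrow> update_code i v (c_local c i) = (s, ms) \<Longrightarrow>
     cut_broadcast ms out \<Longrightarrow>
     step c (Do_Update_Crash i v)
       (c\<lparr>c_chan := send i out (c_chan c), c_crashed := insert i (c_crashed c)\<rparr>)"
| call_snapshot:
  "free c i \<Longrightarrow> i \<notin> c_waiting c \<Longrightarrow>
     step c (Call_Snapshot i) (c\<lparr>c_waiting := insert i (c_waiting c)\<rparr>)"
| return_snapshot:
  "can_return c i \<Longrightarrow>
     step c (Return_Snapshot i (l_X (c_local c i))) (c\<lparr>c_waiting := c_waiting c - {i}\<rparr>)"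
| receive:
  "can_receive c i j \<Longrightarrow> handler i j (hd (c_chan c j i)) (c_local c i) s ms \<Longrightarrow>
     step c (Receive i j)
       (c\<lparr>c_local := (c_local c)(i := s), c_chan := send i (\<lambda>_. ms) (pop i j (c_chan c))\<rparr>)"
| receive_crash:
  "can_receive c i j \<Longrightarrow> handler i j (hd (c_chan c j i)) (c_local c i) s ms \<Longrightarrow>
     cut_broadcast ms out \<Longrightarrow>
     step c (Receive_Crash i j)
       (c\<lparr>c_chan := send i out (pop i j (c_chan c)), c_crashed := insert i (c_crashed c)\<rparr>)"
| crash:
  "i \<notin> c_crashed c \<Longrightarrow> step c (Crash i) (c\<lparr>c_crashed := insert i (c_crashed c)\<rparr>)"
| stutter:
  "step c Stutter c"

text \<open>Finite executions are those that stutter from some point on.\<close>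

record 'p execution =
  conf :: "nat \<Rightarrow> 'p config"
  act :: "nat \<Rightarrow> 'p action"

definition faulty :: "'p execution \<Rightarrow> 'p set" where
  "faulty E = (\<Union>t. c_crashed (conf E t))"

text \<open>Every message put on a channel to a correct process is eventually received, and a correct
  process does not stay forever in front of a \<open>wait\<close> whose condition holds.\<close>

definition fair :: "'p execution \<Rightarrow> bool" where
  "fair E \<longleftrightarrow>
     (\<forall>i. i \<notin> faulty E \<longrightarrow>
        (\<forall>j t. c_chan (conf E t) j i \<noteq> [] \<longrightarrow> (\<exists>u\<ge>t. act E u = Receive i j)) \<and>
        (\<forall>t. \<exists>u\<ge>t. \<not> can_return (conf E u) i))"

definition admissible :: "'p::finite execution \<Rightarrow> bool" where
  "admissible E \<longleftrightarrow>
     conf E 0 = init_config \<and>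
     (\<forall>t. step (conf E t) (act E t) (conf E (Suc t))) \<and>
     2 * card (faulty E) < CARD('p) \<and>
     fair E"


section \<open>Histories of an execution\<close>

text \<open>An operation of an execution is identified with the time of its invocation.\<close>

definition invoked :: "'p execution \<Rightarrow> nat set" where
  "invoked E =
     {t. \<exists>i v. act E t = Do_Update i v \<or> act E t = Do_Update_Crash i v \<or> act E t = Call_Snapshot i}"

definition snapshot_result :: "'p execution \<Rightarrow> nat \<Rightarrow> 'p \<Rightarrow> ('p \<Rightarrow> nat) \<Rightarrow> bool" where
  "snapshot_result E t i a \<longleftrightarrow>
     act E t = Call_Snapshot i \<and>
     (\<exists>u>t. act E u = Return_Snapshot i a \<and>
            (\<forall>w b. t < w \<and> w < u \<longrightarrow> act E w \<noteq> Return_Snapshot i b))"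

definition returned :: "'p execution \<Rightarrow> nat set" where
  "returned E = {t. (\<exists>i v. act E t = Do_Update i v) \<or> (\<exists>i a. snapshot_result E t i a)}"

text \<open>The operation at time \<open>t\<close> may appear in a history as \<open>x\<close>.
  The result of a snapshot that never returns is unconstrained.\<close>

definition appears_as :: "'p execution \<Rightarrow> nat \<Rightarrow> 'p tagged \<Rightarrow> bool" where
  "appears_as E t x \<longleftrightarrow>
     (\<exists>i v. (act E t = Do_Update i v \<or> act E t = Do_Update_Crash i v) \<and> x = (i, Update v)) \<or>
     (\<exists>i a. act E t = Call_Snapshot i \<and> (t \<in> returned E \<longrightarrow> snapshot_result E t i a) \<and>
            x = (i, Snapshot a))"

text \<open>Updates that were postponed and whose process crashed before completing the handler that
  broadcasts the postponed value. Such an update counts as interrupted by the crash although the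
  call has returned: otherwise, when the other processes take infinitely many snapshots,
  no order with finite pasts exists. (\<open>p\<close> calls \<open>update(1)\<close>, then \<open>update(2)\<close>
  before its own record is validated, and crashes; every later snapshot of a correct process
  shows 1 for \<open>p\<close>.)\<close>

definition crash_interrupted :: "'p execution \<Rightarrow> nat set" where
  "crash_interrupted E =
     {t. \<exists>i v. act E t = Do_Update i v \<and> i \<in> faulty E \<and>
               (\<forall>u>t. l_V (c_local (conf E u) i) \<noteq> None)}"

definition models :: "(nat, 'p tagged) history \<Rightarrow> 'p execution \<Rightarrow> bool" where
  "models H E \<longleftrightarrow>
     events H \<subseteq> invoked E \<and>
     returned E - crash_interrupted E \<subseteq> events H \<and>
     (\<forall>t \<in> events H. appears_as E t (op_of H t)) \<and>
     process_order H =
       {(s, t). s \<in> events H \<and> t \<in> events H \<and> s \<le> t \<and> fst (op_of H s) = fst (op_of H t)}"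

end

theory Submission
  imports Defs "HOL-Library.Product_Lexorder" "HOL-Library.Sublist"
begin

text \<open>
  Let every process log all messages it broadcasts; its send clock is the position in this log.
  For two updates \<open>m\<close>, \<open>m'\<close> write \<open>m < m'\<close> if in a majority of the logs some prefix contains
  \<open>m\<close> but not \<open>m'\<close>. The removal loop guarantees \<open>m < m'\<close> whenever some process has validated \<open>m\<close>
  and not \<open>m'\<close>. Since majorities meet, the relation is asymmetric, so the vectors \<open>ValClock\<close> of all
  processes at all times form a chain.

  Sort the operations by the sum of the entries of this vector, where an update takes the least sum of
  a snapshot that shows it, updates come before snapshots of the same sum, and remaining ties are
  broken by time. This order is legal and contains the process order.

  Every operation has a finite past because each update forwarded by a correct process is eventually
  validated at every correct process. If there are finitely many such updates, the set of all of them is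
  never blocked. Otherwise some correct process \<open>k\<close> launches infinitely many updates. As it waits for its
  own updates before launching the next one, it validates all the others too, and a sufficiently large
  set validated by \<open>k\<close> cannot be blocked anywhere.
\<close>

section \<open>Words ordered by a sort key\<close>

text \<open>The relation \<open>m < m'\<close> is asymmetric but, being a majority vote, not
  transitive: updates can block each other in cycles. Validation therefore concerns sets whose
  members precede everything outside, never a least update. The chain property is also what makes
  the sum of entries a faithful rank: of two comparable vectors, the smaller sum belongs to the
  smaller vector. The obstacle to liveness is that the majority behind \<open>m < m'\<close> may
  contain faulty processes, and not all messages in their logs need be delivered. A set is sure to
  be validated only if correct processes witness its precedence. So the large set is taken long
  after the last crash: crashed logs are frozen, so an update that was in no log by then has only
  correct witnesses, while older updates get into all correct logs before their competitors are
  sent. A second obstacle is that a postponed update may be overwritten and never sent. An update is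
  therefore represented by a threshold, the length of its process's log at the invocation, and
  counts as seen once a stamp beyond the threshold is validated.\<close>

lemma last_written_none:
  assumes "\<And>l v. l < m \<Longrightarrow> w l \<noteq> Some (j, Update v)"
  shows "last_written w m j = 0"
  using assms
proof (induction m)
  case (Suc m)
  then show ?case by (auto split: option.splits oper.splits)
qed simp

lemma last_written_eq:
  assumes "l < m" "w l = Some (j, Update v)" "\<And>l' v'. l < l' \<Longrightarrow> l' < m \<Longrightarrow> w l' \<noteq> Some (j, Update v')"
  shows "last_written w m j = v"
  using assms
proof (induction m)
  case (Suc m)
  show ?case
  proof (cases "l = m")
    case False
    then have "last_written w m j = v" using Suc by simp
    moreover have "w m \<noteq> Some (j, Update v')" for v' using Suc.prems(1,3) False by simp
    ultimately show ?thesis by (auto split: option.splits oper.splits)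
  qed (use Suc in simp)
qed simp

text \<open>The rank of an event is the number of events of smaller key, so the word lists the
  events by increasing key and the specification can be checked on keys alone. Any linear order may
  serve as key; finite pasts turn it into positions.\<close>

lemma sequentially_consistent_snapshotI:
  fixes H :: "('e, 'p tagged) history" and f :: "'e \<Rightarrow> 'k::linorder"
  assumes inj: "inj_on f (events H)"
    and fin: "\<And>e. e \<in> events H \<Longrightarrow> finite {e' \<in> events H. f e' \<le> f e}"
    and po: "\<And>e e'. (e, e') \<in> process_order H \<Longrightarrow> e \<in> events H \<and> e' \<in> events H \<and> f e \<le> f e'"
    and snap: "\<And>e i a j. e \<in> events H \<Longrightarrow> op_of H e = (i, Snapshot a) \<Longrightarrow>
      (a j = 0 \<and> (\<forall>x \<in> events H. \<forall>v. op_of H x = (j, Update v) \<longrightarrow> \<not> f x < f e)) \<or>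
      (\<exists>x \<in> events H. op_of H x = (j, Update (a j)) \<and> f x < f e \<and>
        (\<forall>y \<in> events H. \<forall>v. op_of H y = (j, Update v) \<longrightarrow> f y < f e \<longrightarrow> f y \<le> f x))"
  shows "sequentially_consistent snapshot_spec H"
proof -
  define R where "R = {(e, e'). e \<in> events H \<and> e' \<in> events H \<and> f e \<le> f e'}"
  have "linear_order_on (events H) R"
    unfolding order_on_defs refl_on_def trans_def antisym_def total_on_def R_def
    using inj by (auto dest: inj_onD)
  moreover have "process_order H \<subseteq> R" unfolding R_def using po by auto
  moreover have "finite {e'. (e', e) \<in> R}" if "e \<in> events H" for e
    using fin[OF that] that unfolding R_def by simp
  moreover have "word_of H R \<in> snapshot_spec"
  proof -
    let ?w = "word_of H R"
    let ?past = "\<lambda>e. {e' \<in> events H. f e' < f e}"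
    have rank: "rank H R e = card (?past e)" if "e \<in> events H" for e
      unfolding rank_def R_def using that inj
      by (intro arg_cong[where f = card]) (auto simp: order_less_le dest: inj_onD)
    have finp: "finite (?past e)" if "e \<in> events H" for e
      by (rule finite_subset[OF _ fin[OF that]]) auto
    have less: "rank H R e < rank H R e'" if "e \<in> events H" "e' \<in> events H" "f e < f e'" for e e'
      unfolding rank[OF that(1)] rank[OF that(2)]
      by (rule psubset_card_mono[OF finp[OF that(2)]]) (use that in auto)
    have less_iff: "rank H R e < rank H R e' \<longleftrightarrow> f e < f e'" if "e \<in> events H" "e' \<in> events H" for e e'
      using less[OF that] less[OF that(2,1)] inj_onD[OF inj _ that]
      by (metis linorder_less_linear less_asym)
    have inj_rank: "e = e'" if "e \<in> events H" "e' \<in> events H" "rank H R e = rank H R e'" for e e'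
      using less_iff[OF that(1,2)] less_iff[OF that(2,1)] that(3) inj_onD[OF inj _ that(1,2)]
      by (metis linorder_less_linear less_irrefl)
    have at: "?w (rank H R e) = Some (op_of H e)" if "e \<in> events H" for e
    proof -
      have "(THE e'. e' \<in> events H \<and> rank H R e' = rank H R e) = e"
        using that inj_rank by (intro the_equality) auto
      then show ?thesis unfolding word_of_def using that by auto
    qed
    have ex: "\<exists>e \<in> events H. rank H R e = m \<and> x = op_of H e" if w: "?w m = Some x" for m x
    proof -
      obtain e where "e \<in> events H" "rank H R e = m"
        using w unfolding word_of_def by (metis option.distinct(1))
      then show ?thesis using at w by (metis option.inject)
    qed
    have "is_word ?w"
      unfolding is_word_def
    proof (intro allI impI)
      fix l m assume lm: "l \<le> m \<and> ?w m \<noteq> None"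
      then obtain e where e: "e \<in> events H" "rank H R e = m" using ex by blast
      show "?w l \<noteq> None"
      proof (cases "l = m")
        case False
        \<comment> \<open>The word has no gaps: the \<open>m\<close> predecessors of
          \<open>e\<close> have distinct ranks below \<open>m\<close>, so every such rank is
          taken.\<close>
        have "rank H R ` ?past e \<subseteq> {..<m}" using less e by auto
        moreover have "inj_on (rank H R) (?past e)" using inj_rank by (auto intro: inj_onI)
        then have "card (rank H R ` ?past e) = card {..<m}"
          using rank[OF e(1)] e(2) by (simp add: card_image)
        ultimately have "rank H R ` ?past e = {..<m}" by (simp add: card_subset_eq)
        then obtain e' where "e' \<in> events H" "rank H R e' = l" using lm False
          by (metis (no_types, lifting) imageE lessThan_iff mem_Collect_eq order_le_less)
        then show ?thesis using at by force
      qed (use lm in simp)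
    qed
    moreover have "a j = last_written ?w m j" if w: "?w m = Some (i, Snapshot a)" for m i a j
    proof -
      obtain e where e: "e \<in> events H" "rank H R e = m" "op_of H e = (i, Snapshot a)"
        using ex[OF w] by metis
      from snap[OF e(1,3), of j] show ?thesis
      proof (elim disjE conjE bexE)
        assume *: "a j = 0" "\<forall>x\<in>events H. \<forall>v. op_of H x = (j, Update v) \<longrightarrow> \<not> f x < f e"
        have "last_written ?w m j = 0"
        proof (rule last_written_none, rule notI)
          fix l v assume l: "l < m" "?w l = Some (j, Update v)"
          obtain x where "x \<in> events H" "rank H R x = l" "op_of H x = (j, Update v)"
            using ex[OF l(2)] by metis
          then show False using * l(1) less_iff e by blast
        qed
        then show ?thesis using * by simp
      next
        fix x assume x: "x \<in> events H" "op_of H x = (j, Update (a j))" "f x < f e"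
          "\<forall>y\<in>events H. \<forall>v. op_of H y = (j, Update v) \<longrightarrow> f y < f e \<longrightarrow> f y \<le> f x"
        have "last_written ?w m j = a j"
        proof (rule last_written_eq)
          show "rank H R x < m" using less[OF x(1) e(1) x(3)] e(2) by simp
          show "?w (rank H R x) = Some (j, Update (a j))" using at[OF x(1)] x(2) by simp
          fix l v assume l: "rank H R x < l" "l < m"
          show "?w l \<noteq> Some (j, Update v)"
          proof
            assume "?w l = Some (j, Update v)"
            then obtain y where y: "y \<in> events H" "rank H R y = l" "op_of H y = (j, Update v)"
              using ex by metis
            then have "f y < f e" "f x < f y" using l e less_iff x(1) by blast+
            then show False using x(4) y by (meson not_le)
          qed
        qed
        then show ?thesis by simp
      qed
    qed
    ultimately show ?thesis unfolding snapshot_spec_def by blast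
  qed
  ultimately show ?thesis unfolding sequentially_consistent_def by blast
qed

section \<open>Message logs\<close>

fun key :: "'p message \<Rightarrow> 'p \<times> nat" where
  "key (Message v k t c) = (k, t)"

fun clock :: "'p message \<Rightarrow> nat" where
  "clock (Message v k t c) = c"

abbreviation keys :: "'p message list \<Rightarrow> ('p \<times> nat) set" where
  "keys xs \<equiv> key ` set xs"

text \<open>Prefixes make a key that is absent from the log count as last, just as
  \<open>\<infinity>\<close> does in a record, and make the relation survive every extension of the
  log.\<close>

definition before :: "'p message list \<Rightarrow> 'p \<times> nat \<Rightarrow> 'p \<times> nat \<Rightarrow> bool" where
  "before xs m m' \<longleftrightarrow> (\<exists>ys. prefix ys xs \<and> m \<in> keys ys \<and> m' \<notin> keys ys)"

lemma before_asym: "before xs m m' \<Longrightarrow> \<not> before xs m' m"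
proof
  assume "before xs m m'" "before xs m' m"
  then obtain ys zs where *: "prefix ys xs" "m \<in> keys ys" "m' \<notin> keys ys"
    "prefix zs xs" "m' \<in> keys zs" "m \<notin> keys zs"
    unfolding before_def by blast
  then have "prefix ys zs \<or> prefix zs ys" by (metis prefix_same_cases)
  then have "set ys \<subseteq> set zs \<or> set zs \<subseteq> set ys" using set_mono_prefix by blast
  then show False using * by blast
qed

lemma before_mono: "before xs m m' \<Longrightarrow> prefix xs ys \<Longrightarrow> before ys m m'"
  unfolding before_def using prefix_order.trans by blast

lemma before_prefix_mem:
  assumes "before xs m m'" "prefix ys xs" "m' \<in> keys ys"
  shows "m \<in> keys ys" "before ys m m'"
proof -
  obtain zs where zs: "prefix zs xs" "m \<in> keys zs" "m' \<notin> keys zs"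
    using assms(1) unfolding before_def by blast
  have "prefix zs ys \<or> prefix ys zs" using zs(1) assms(2) by (rule prefix_same_cases)
  moreover have "\<not> prefix ys zs" using zs(3) assms(3) by (auto dest: set_mono_prefix)
  ultimately have p: "prefix zs ys" by blast
  show "m \<in> keys ys" using set_mono_prefix[OF p] zs(2) by blast
  show "before ys m m'" using p zs unfolding before_def by blast
qed

lemma before_sent: "before xs m m' \<Longrightarrow> m \<in> keys xs"
  unfolding before_def using set_mono_prefix by blast

lemma beforeI_unsent: "m \<in> keys ys \<Longrightarrow> m' \<notin> keys ys \<Longrightarrow> prefix ys xs \<Longrightarrow> before xs m m'"
  unfolding before_def by blast

text \<open>A prefix that contains \<open>m\<close> already decides the order: the witnessing prefix
  either lies inside it or extends it, and in the latter case the shorter one is a witness itself.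
  Received parts of a log thus inherit the order of the full log.\<close>

lemma before_prefix:
  assumes "before xs m m'" "prefix ys xs" "m \<in> keys ys"
  shows "before ys m m'"
proof -
  obtain zs where zs: "prefix zs xs" "m \<in> keys zs" "m' \<notin> keys zs"
    using assms(1) unfolding before_def by blast
  have "prefix zs ys \<or> prefix ys zs" using zs(1) assms(2) by (rule prefix_same_cases)
  then show ?thesis
  proof
    assume "prefix ys zs"
    then have "m' \<notin> keys ys" using zs(3) set_mono_prefix by blast
    then show ?thesis using assms(3) by (blast intro: beforeI_unsent)
  qed (use zs in \<open>auto simp: before_def\<close>)
qed

lemma majority_mono: "majority A \<Longrightarrow> A \<subseteq> B \<Longrightarrow> majority (B :: 'p::finite set)"
  unfolding majority_def by (meson card_mono finite less_le_trans mult_le_mono2)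

lemma majority_meet:
  assumes "majority A" "majority (B :: 'p::finite set)"
  obtains l where "l \<in> A" "l \<in> B"
proof -
  have "card (A \<union> B) \<le> CARD('p)" by (simp add: card_mono)
  moreover have "card A + card B = card (A \<union> B) + card (A \<inter> B)"
    by (rule card_Un_Int) simp_all
  ultimately have "card (A \<inter> B) > 0" using assms unfolding majority_def by linarith
  then have "A \<inter> B \<noteq> {}" by auto
  then show ?thesis using that by blast
qed

lemma not_majority_empty [simp]: "\<not> majority {}"
  by (simp add: majority_def)

definition clocked :: "'p message list \<Rightarrow> bool" where
  "clocked xs \<longleftrightarrow> (\<forall>p < length xs. clock (xs ! p) = Suc p)"

text \<open>The third clause traces every forwarded message to an original whose clock is its stamp.
  The fourth is what FIFO channels leave behind: a log containing an update of \<open>k\<close>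
  contains all updates that \<open>k\<close> logged under smaller stamps, and earlier.\<close>

definition wf_log :: "('p \<Rightarrow> 'p message list) \<Rightarrow> bool" where
  "wf_log S \<longleftrightarrow>
     (\<forall>i. clocked (S i)) \<and>
     (\<forall>i. distinct (map key (S i))) \<and>
     (\<forall>i v k t c. Message v k t c \<in> set (S i) \<longrightarrow> Message v k t t \<in> set (S k)) \<and>
     (\<forall>i k t t'. (k, t') \<in> keys (S i) \<longrightarrow> (k, t) \<in> keys (S k) \<longrightarrow> t < t' \<longrightarrow>
        before (S i) (k, t) (k, t'))"

lemma clocked_nth:
  assumes "clocked xs" "Message v k t c \<in> set xs"
  shows "0 < c" "c \<le> length xs" "xs ! (c - 1) = Message v k t c"
proof -
  obtain p where p: "p < length xs" "xs ! p = Message v k t c"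
    using assms(2) by (metis in_set_conv_nth)
  then have "c = Suc p" using assms(1) unfolding clocked_def by (metis clock.simps)
  then show "0 < c" "c \<le> length xs" "xs ! (c - 1) = Message v k t c" using p by auto
qed

lemma clocked_append:
  "clocked (xs @ [m]) \<longleftrightarrow> clocked xs \<and> clock m = Suc (length xs)"
  unfolding clocked_def by (auto simp: nth_append less_Suc_eq)

lemma clocked_prefix: "clocked xs \<Longrightarrow> prefix ys xs \<Longrightarrow> clocked ys"
  unfolding clocked_def prefix_def by (metis length_append nth_append trans_less_add1)

lemma clocked_prefix_mem:
  assumes "clocked ys" "prefix xs ys" "Message v k t c \<in> set ys" "c \<le> length xs"
  shows "Message v k t c \<in> set xs"
proof -
  note n = clocked_nth[OF assms(1,3)]
  have lt: "c - 1 < length xs" using n(1) assms(4) by simp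
  then have "xs ! (c - 1) = Message v k t c"
    using n(3) assms(2) by (auto simp: prefix_def nth_append)
  then show ?thesis using lt nth_mem by metis
qed

lemma keyE:
  assumes "m \<in> keys xs"
  obtains v c where "Message v (fst m) (snd m) c \<in> set xs"
proof -
  obtain x where "x \<in> set xs" "key x = m" using assms by blast
  moreover obtain v k t c where "x = Message v k t c" using message.exhaust by blast
  ultimately show ?thesis using that by auto
qed

text \<open>Clocks are positions and \<open>\<infinity>\<close> means absence, so the prefix of
  length \<open>c\<close> is a witness. This translates the comparison made by the code into the
  order of the log.\<close>

lemma before_clock_iff:
  assumes cl: "clocked xs" and k: "\<And>c. a = enat c \<longleftrightarrow> (\<exists>v. Message v k t c \<in> set xs)"
    and k': "\<And>c. a' = enat c \<longleftrightarrow> (\<exists>v. Message v k' t' c \<in> set xs)"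
  shows "a < a' \<longleftrightarrow> before xs (k, t) (k', t')"
proof
  assume less: "a < a'"
  then obtain c where c: "a = enat c" by (cases a) auto
  then obtain v where v: "Message v k t c \<in> set xs" using k by blast
  note n = clocked_nth[OF cl v]
  let ?ys = "take c xs"
  have "Message v k t c \<in> set ?ys"
    using n by (metis diff_less in_set_conv_nth length_take min.absorb2 nth_take zero_less_one)
  then have 1: "(k, t) \<in> keys ?ys" by force
  have "(k', t') \<notin> keys ?ys"
  proof
    assume "(k', t') \<in> keys ?ys"
    then obtain v' c' where m': "Message v' k' t' c' \<in> set ?ys" by (metis keyE fst_conv snd_conv)
    then have "a' = enat c'" using k' in_set_takeD[OF m'] by blast
    moreover have "c' \<le> c"
      using clocked_nth(2)[OF clocked_prefix[OF cl take_is_prefix] m'] by simp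
    ultimately show False using less c by simp
  qed
  then show "before xs (k, t) (k', t')" using 1 beforeI_unsent take_is_prefix by blast
next
  assume "before xs (k, t) (k', t')"
  then obtain ys where ys: "prefix ys xs" "(k, t) \<in> keys ys" "(k', t') \<notin> keys ys"
    unfolding before_def by blast
  then obtain v c where m: "Message v k t c \<in> set ys" by (metis keyE fst_conv snd_conv)
  have a: "a = enat c" using m set_mono_prefix[OF ys(1)] k by blast
  have c: "c \<le> length ys" using clocked_nth(2)[OF clocked_prefix[OF cl ys(1)] m] .
  show "a < a'"
  proof (cases a')
    case (enat c')
    then obtain v' where v': "Message v' k' t' c' \<in> set xs" using k' by blast
    note n = clocked_nth[OF cl v']
    have "\<not> c' \<le> length ys"
    proof
      assume le: "c' \<le> length ys"
      then have "ys ! (c' - 1) = Message v' k' t' c'"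
        using n ys(1)
        by (metis One_nat_def Suc_le_lessD Suc_pred' nth_append prefix_def le)
      then have "Message v' k' t' c' \<in> set ys" using le n(1)
        by (metis Suc_pred' Suc_le_lessD nth_mem One_nat_def)
      then show False using ys(3) by force
    qed
    then show ?thesis using a c enat by simp
  qed (simp add: a)
qed

lemma wf_log_own:
  assumes "wf_log S" "(k, t) \<in> keys (S i)"
  obtains v where "Message v k t t \<in> set (S k)" "0 < t" "t \<le> length (S k)"
    "S k ! (t - 1) = Message v k t t"
proof -
  obtain v c where "Message v k t c \<in> set (S i)" using assms(2) by (metis keyE fst_conv snd_conv)
  then have v: "Message v k t t \<in> set (S k)" using assms(1) unfolding wf_log_def by blast
  have "clocked (S k)" using assms(1) unfolding wf_log_def by blast
  from that[OF v clocked_nth[OF this v]] show ?thesis .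
qed

lemma wf_log_key_eq:
  assumes "wf_log S" "Message v k t c \<in> set (S i)" "Message v' k t c' \<in> set (S i)"
  shows "v = v'" "c = c'"
proof -
  have "distinct (map key (S i))" using assms(1) unfolding wf_log_def by blast
  then have "Message v k t c = Message v' k t c'"
    using assms(2,3) by (metis distinct_map inj_on_def key.simps)
  then show "v = v'" "c = c'" by auto
qed

lemma wf_log_append:
  assumes wf: "wf_log S" and new: "(k, t) \<notin> keys (S i)"
    and own: "k = i \<Longrightarrow> t = Suc (length (S i))"
    and other: "k \<noteq> i \<Longrightarrow> Message v k t t \<in> set (S k)"
    and ord: "\<And>t0. (k, t0) \<in> keys (S k) \<Longrightarrow> t0 < t \<Longrightarrow> (k, t0) \<in> keys (S i)"
  shows "wf_log (S(i := S i @ [Message v k t (Suc (length (S i)))]))" (is "wf_log ?S")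
proof -
  note w = wf[unfolded wf_log_def]
  have pre: "prefix (S l) (?S l)" for l by simp
  have 1: "clocked (?S l)" for l using w by (auto simp: clocked_append)
  have 2: "distinct (map key (?S l))" for l using w new by auto
  have 3: "Message v' k' t' t' \<in> set (?S k')" if "Message v' k' t' c \<in> set (?S l)" for l v' k' t' c
  proof (cases "Message v' k' t' c \<in> set (S l)")
    case True
    then have "Message v' k' t' t' \<in> set (S k')" using w by blast
    then show ?thesis using set_mono_prefix[OF pre] by blast
  next
    case False
    then have "l = i" "v' = v" "k' = k" "t' = t" "c = Suc (length (S i))"
      using that by (auto split: if_splits)
    then show ?thesis using own other by (cases "k = i") auto
  qed
  have 4: "before (?S l) (k', t1) (k', t2)"
    if a: "(k', t2) \<in> keys (?S l)" "(k', t1) \<in> keys (?S k')" "t1 < t2" for l k' t1 t2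
  proof -
    \<comment> \<open>A new update of \<open>i\<close> itself carries a stamp beyond the whole log,
      so it cannot be the smaller of two stamps.\<close>
    have t1: "(k', t1) \<in> keys (S k')"
    proof (rule ccontr)
      assume "(k', t1) \<notin> keys (S k')"
      then have e: "k' = i" "k = i" "t1 = t" using a(2) by (auto split: if_splits)
      then have t: "t1 = Suc (length (S i))" using own by simp
      have "(k', t2) \<in> keys (S l)" using a(1,3) e by (auto split: if_splits)
      then have "t2 \<le> length (S i)" using wf_log_own[OF wf] e by metis
      then show False using t a(3) by simp
    qed
    show ?thesis
    proof (cases "(k', t2) \<in> keys (S l)")
      case True
      then have "before (S l) (k', t1) (k', t2)" using w t1 a(3) by blast
      then show ?thesis using before_mono pre by blast
    next
      case False
      then have "l = i" "k' = k" "t2 = t" using a(1) by (auto split: if_splits)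
      then have "(k', t1) \<in> keys (S i)" using ord t1 a(3) by simp
      then show ?thesis using \<open>l = i\<close> \<open>k' = k\<close> \<open>t2 = t\<close> new pre[of i] by (auto intro: beforeI_unsent)
    qed
  qed
  show ?thesis unfolding wf_log_def using 1 2 3 4 by blast
qed

section \<open>Records and validation\<close>

definition heard :: "('p \<Rightarrow> 'p message list) \<Rightarrow> ('p \<Rightarrow> nat) \<Rightarrow> 'p \<times> nat \<Rightarrow> bool" where
  "heard S \<rho> m \<longleftrightarrow> (\<exists>l. m \<in> keys (take (\<rho> l) (S l)))"

definition entry_key :: "'p entry \<Rightarrow> 'p \<times> nat" where
  "entry_key g = (e_k g, e_t g)"

definition record_ok :: "('p \<Rightarrow> 'p message list) \<Rightarrow> ('p \<Rightarrow> nat) \<Rightarrow> 'p entry \<Rightarrow> bool" where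
  "record_ok S \<rho> g \<longleftrightarrow>
     Message (e_v g) (e_k g) (e_t g) (e_t g) \<in> set (S (e_k g)) \<and>
     heard S \<rho> (entry_key g) \<and>
     (\<forall>l c. e_cl g l = enat c \<longleftrightarrow> (\<exists>v. Message v (e_k g) (e_t g) c \<in> set (take (\<rho> l) (S l))))"

text \<open>Here \<open>\<rho> l\<close> is the number of messages of the log of \<open>l\<close> that the process with local state \<open>s\<close>
  has received.\<close>

definition view_inv :: "('p::finite \<Rightarrow> 'p message list) \<Rightarrow> ('p \<Rightarrow> nat) \<Rightarrow> 'p lstate \<Rightarrow> bool" where
  "view_inv S \<rho> s \<longleftrightarrow>
     (\<forall>l. \<rho> l \<le> length (S l)) \<and>
     (\<forall>g \<in> l_G s. l_ValClock s (e_k g) < e_t g \<and> record_ok S \<rho> g) \<and>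
     inj_on entry_key (l_G s) \<and>
     (\<forall>k t. heard S \<rho> (k, t) \<longrightarrow> t \<le> l_ValClock s k \<or> (k, t) \<in> entry_key ` l_G s) \<and>
     (\<forall>k. l_ValClock s k = 0 \<and> l_X s k = 0 \<or>
          Message (l_X s k) k (l_ValClock s k) (l_ValClock s k) \<in> set (S k)) \<and>
     (\<forall>k t k' t'. (k, t) \<in> keys (S k) \<longrightarrow> t \<le> l_ValClock s k \<longrightarrow> l_ValClock s k' < t' \<longrightarrow>
          majority {l. before (S l) (k, t) (k', t')}) \<and>
     (\<forall>k t. (k, t) \<in> keys (S k) \<longrightarrow> t \<le> l_ValClock s k \<longrightarrow> heard S \<rho> (k, t))"

lemma view_invD:
  assumes "view_inv S \<rho> s"
  shows "\<rho> l \<le> length (S l)"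
    "g \<in> l_G s \<Longrightarrow> l_ValClock s (e_k g) < e_t g" "g \<in> l_G s \<Longrightarrow> record_ok S \<rho> g"
    "inj_on entry_key (l_G s)"
    "heard S \<rho> (k, t) \<Longrightarrow> t \<le> l_ValClock s k \<or> (k, t) \<in> entry_key ` l_G s"
    "l_ValClock s k = 0 \<and> l_X s k = 0 \<or>
          Message (l_X s k) k (l_ValClock s k) (l_ValClock s k) \<in> set (S k)"
    "(k, t) \<in> keys (S k) \<Longrightarrow> t \<le> l_ValClock s k \<Longrightarrow> l_ValClock s k' < t' \<Longrightarrow>
          majority {l. before (S l) (k, t) (k', t')}"
    "(k, t) \<in> keys (S k) \<Longrightarrow> t \<le> l_ValClock s k \<Longrightarrow> heard S \<rho> (k, t)"
  using assms unfolding view_inv_def by blast+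

lemma view_inv_cong:
  "l_X s' = l_X s \<Longrightarrow> l_ValClock s' = l_ValClock s \<Longrightarrow> l_G s' = l_G s \<Longrightarrow> view_inv S \<rho> s' = view_inv S \<rho> s"
  unfolding view_inv_def by simp

lemma take_prefix_eq: "prefix xs ys \<Longrightarrow> n \<le> length xs \<Longrightarrow> take n ys = take n xs"
  by (auto simp: prefix_def)

text \<open>Growing logs could harm only the clauses about keys of \<open>S k\<close> up to the
  validated stamp. That stamp lies within the old log of \<open>k\<close>, whereas a new own key has
  a stamp beyond it.\<close>

lemma view_inv_mono:
  assumes view_inv: "view_inv S \<rho> s" and wf: "wf_log S'" and pre: "\<And>l. prefix (S l) (S' l)"
  shows "view_inv S' \<rho> s"
proof -
  note c = view_invD[OF view_inv]
  have sub: "set (S l) \<subseteq> set (S' l)" for l using set_mono_prefix[OF pre] .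
  have tk: "take (\<rho> l) (S' l) = take (\<rho> l) (S l)" for l using take_prefix_eq[OF pre c(1)] .
  have hd: "heard S' \<rho> = heard S \<rho>" unfolding heard_def tk ..
  have len: "\<rho> l \<le> length (S' l)" for l using c(1)[of l] prefix_length_le[OF pre[of l]] by simp
  have rec: "record_ok S' \<rho> g" if "g \<in> l_G s" for g
    using c(3)[OF that] sub unfolding record_ok_def hd tk by blast
  have val: "l_ValClock s k = 0 \<and> l_X s k = 0 \<or>
          Message (l_X s k) k (l_ValClock s k) (l_ValClock s k) \<in> set (S' k)" for k
    using c(6)[of k] sub[of k] by blast
  have old: "(k, t) \<in> keys (S k)" if kt: "(k, t) \<in> keys (S' k)" "t \<le> l_ValClock s k" for k t
  proof -
    obtain v where v: "Message v k t t \<in> set (S' k)" "0 < t" using wf_log_own[OF wf kt(1)] .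
    have cl: "clocked (S' k)" using wf unfolding wf_log_def by blast
    then have "clocked (S k)" using clocked_prefix pre by blast
    then have "l_ValClock s k \<le> length (S k)"
      using c(6)[of k] clocked_nth(2) v(2) kt(2) by fastforce
    then have "Message v k t t \<in> set (S k)"
      using clocked_prefix_mem[OF cl pre v(1)] kt(2) by simp
    then show ?thesis by force
  qed
  have maj: "majority {l. before (S' l) (k, t) (k', t')}"
    if "(k, t) \<in> keys (S' k)" "t \<le> l_ValClock s k" "l_ValClock s k' < t'" for k t k' t'
    using c(7)[OF old[OF that(1,2)] that(2,3)]
    by (rule majority_mono) (use before_mono pre in blast)
  show ?thesis unfolding view_inv_def hd
    using len rec val maj old c(2,4,5,8) by blast
qed

lemma heard_received:
  assumes "\<rho> j < length (S j)"
  shows "heard S (\<rho>(j := Suc (\<rho> j))) m \<longleftrightarrow> heard S \<rho> m \<or> m = key (S j ! \<rho> j)"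
  using assms unfolding heard_def by (auto simp: take_Suc_conv_app_nth)

lemma record_ok_received_other:
  assumes "record_ok S \<rho> g" "\<rho> j < length (S j)" "entry_key g \<noteq> key (S j ! \<rho> j)"
  shows "record_ok S (\<rho>(j := Suc (\<rho> j))) g"
proof -
  have tk: "set (take ((\<rho>(j := Suc (\<rho> j))) l) (S l)) =
      set (take (\<rho> l) (S l)) \<union> (if l = j then {S j ! \<rho> j} else {})" for l
    using assms(2) by (auto simp: take_Suc_conv_app_nth)
  have "Message v (e_k g) (e_t g) c \<noteq> S j ! \<rho> j" for v c
    using assms(3) unfolding entry_key_def by (metis key.simps)
  then show ?thesis
    using assms(1) heard_received[of \<rho> j S] assms(2) unfolding record_ok_def tk by auto
qed

text \<open>The three cases are the branches of code (A): already validated, record present, first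
  message about this update. The last conclusion is the exact dichotomy on sending: a message is
  forwarded when it is the first news of an update of another process.\<close>

lemma view_inv_receive:
  assumes wf: "wf_log S" and view_inv: "view_inv S \<rho> s" and \<rho>: "\<rho> j < length (S j)"
    and code: "record_code i j (S j ! \<rho> j) s = (s1, ms)"
  shows "view_inv S (\<rho>(j := Suc (\<rho> j))) s1"
    and "l_V s1 = l_V s" "l_X s1 = l_X s" "l_ValClock s1 = l_ValClock s"
    and "ms = [] \<and> l_SendClock s1 = l_SendClock s \<and>
           (heard S \<rho> (key (S j ! \<rho> j)) \<or> fst (key (S j ! \<rho> j)) = i) \<or>
         (\<exists>v k t c. S j ! \<rho> j = Message v k t c \<and> k \<noteq> i \<and> \<not> heard S \<rho> (k, t) \<and>
           ms = [Message v k t (Suc (l_SendClock s))] \<and> l_SendClock s1 = Suc (l_SendClock s))"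
proof -
  note c = view_invD[OF view_inv]
  obtain v k t cc where m: "S j ! \<rho> j = Message v k t cc" using message.exhaust by blast
  let ?\<rho> = "\<rho>(j := Suc (\<rho> j))"
  have mem: "Message v k t cc \<in> set (S j)" using \<rho> m by (metis nth_mem)
  have own: "Message v k t t \<in> set (S k)" using mem wf unfolding wf_log_def by blast
  have hd: "heard S ?\<rho> x \<longleftrightarrow> heard S \<rho> x \<or> x = (k, t)" for x
    using heard_received[of \<rho> j S x] \<rho> m by simp
  have tk: "set (take (?\<rho> l) (S l)) = set (take (\<rho> l) (S l)) \<union> (if l = j then {Message v k t cc} else {})" for l
    using \<rho> m by (auto simp: take_Suc_conv_app_nth)
  have len: "?\<rho> l \<le> length (S l)" for l using c(1)[of l] \<rho> by simp
  have oth: "record_ok S ?\<rho> g" if "g \<in> l_G s" "entry_key g \<noteq> (k, t)" for g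
    using record_ok_received_other[of S \<rho> g j] c(3)[OF that(1)] \<rho> that(2) m by simp
  have hk: "heard S ?\<rho> (k, t)" using hd by simp
  \<comment> \<open>The set equation is the common form of the three branches: afterwards the
    received key has a record unless it is validated already.\<close>
  have viewI: "view_inv S ?\<rho> s1"
    if "l_X s1 = l_X s" "l_ValClock s1 = l_ValClock s"
      "\<And>g. g \<in> l_G s1 \<Longrightarrow> l_ValClock s (e_k g) < e_t g \<and> record_ok S ?\<rho> g"
      "inj_on entry_key (l_G s1)" "entry_key ` l_G s1 \<union> {x. x = (k, t) \<and> t \<le> l_ValClock s k} = entry_key ` l_G s \<union> {(k, t)}"
  proof -
    have "t' \<le> l_ValClock s k' \<or> (k', t') \<in> entry_key ` l_G s1" if "heard S ?\<rho> (k', t')" for k' t'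
      using that c(5)[of k' t'] \<open>_ = entry_key ` l_G s \<union> {(k, t)}\<close> unfolding hd by blast
    moreover have "heard S ?\<rho> (k', t')" if "(k', t') \<in> keys (S k')" "t' \<le> l_ValClock s k'" for k' t'
      using c(8)[OF that] hd by blast
    ultimately show ?thesis unfolding view_inv_def that(1,2) using len that(3,4) c(6,7) by blast
  qed
  consider (old) "t \<le> l_ValClock s k" | (ack) "l_ValClock s k < t" "(k, t) \<in> entry_key ` l_G s"
    | (new) "l_ValClock s k < t" "(k, t) \<notin> entry_key ` l_G s" by linarith
  then have "view_inv S ?\<rho> s1 \<and> l_V s1 = l_V s \<and> l_X s1 = l_X s \<and> l_ValClock s1 = l_ValClock s \<and>
      (ms = [] \<and> l_SendClock s1 = l_SendClock s \<and> (heard S \<rho> (k, t) \<or> k = i) \<or>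
       k \<noteq> i \<and> \<not> heard S \<rho> (k, t) \<and>
           ms = [Message v k t (Suc (l_SendClock s))] \<and> l_SendClock s1 = Suc (l_SendClock s))"
  proof cases
    case old
    then have s1: "s1 = s" "ms = []" using code m by auto
    have "heard S \<rho> (k, t)" using own old by (intro c(8)) force+
    moreover have ne: "entry_key g \<noteq> (k, t)" if "g \<in> l_G s" for g using c(2)[OF that] old unfolding entry_key_def by auto
    then have "view_inv S ?\<rho> s1" using oth c(2,4,5) \<open>heard S \<rho> (k, t)\<close> old unfolding s1
      by (intro viewI[unfolded s1]) auto
    ultimately show ?thesis using s1 by simp
  next
    case ack
    let ?u = "\<lambda>g. if e_k g = k \<and> e_t g = t then g\<lparr>e_cl := (e_cl g)(j := enat cc)\<rparr> else g"
    have ex: "\<exists>g \<in> l_G s. e_k g = k \<and> e_t g = t" using ack(2) unfolding entry_key_def by auto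
    then have s1: "s1 = s\<lparr>l_G := ?u ` l_G s\<rparr>" "ms = []" using code m ack(1) by auto
    have ek: "entry_key (?u g) = entry_key g" for g unfolding entry_key_def by simp
    obtain g where g: "g \<in> l_G s" "entry_key g = (k, t)" using ack(2) by auto
    then have h: "heard S \<rho> (k, t)" using c(3)[OF g(1)] unfolding record_ok_def by simp
    have ok: "record_ok S ?\<rho> (?u g)" if g: "g \<in> l_G s" for g
    proof (cases "entry_key g = (k, t)")
      case False
      then show ?thesis using oth[OF g] unfolding entry_key_def by auto
    next
      case True
      then have kt: "e_k g = k" "e_t g = t" unfolding entry_key_def by auto
      have r: "record_ok S \<rho> g" using c(3)[OF g] .
      \<comment> \<open>A log contains each key only once, so the clock just received is the only
        possible value of entry \<open>j\<close>.\<close>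
      have "(enat cc = enat c') \<longleftrightarrow> (\<exists>v'. Message v' k t c' \<in> set (take (?\<rho> j) (S j)))" for c'
      proof
        assume "\<exists>v'. Message v' k t c' \<in> set (take (?\<rho> j) (S j))"
        then obtain v' where "Message v' k t c' \<in> set (S j)" using in_set_takeD by fast
        then show "enat cc = enat c'" using wf_log_key_eq(2)[OF wf mem] by blast
      qed (use tk[of j] in auto)
      moreover have "(e_cl g l = enat c') \<longleftrightarrow> (\<exists>v'. Message v' k t c' \<in> set (take (?\<rho> l) (S l)))" if "l \<noteq> j" for l c'
        using r that unfolding record_ok_def kt by simp
      ultimately show ?thesis using r hk kt unfolding record_ok_def entry_key_def
        by (simp del: fun_upd_apply) (simp add: fun_upd_def)
    qed
    have "view_inv S ?\<rho> s1"
    proof (rule viewI)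
      show "l_ValClock s (e_k g) < e_t g \<and> record_ok S ?\<rho> g" if "g \<in> l_G s1" for g
      proof -
        obtain g0 where g0: "g0 \<in> l_G s" "g = ?u g0" using \<open>g \<in> l_G s1\<close> unfolding s1 by auto
        show ?thesis using ok[OF g0(1)] c(2)[OF g0(1)] ek[of g0] unfolding g0(2) entry_key_def
          by (simp del: fun_upd_apply)
      qed
      have "inj_on entry_key (?u ` l_G s)"
      proof (rule inj_on_imageI)
        have "entry_key \<circ> ?u = entry_key" using ek by (rule_tac ext) (simp del: fun_upd_apply)
        then show "inj_on (entry_key \<circ> ?u) (l_G s)" using c(4) by simp
      qed
      then show "inj_on entry_key (l_G s1)" unfolding s1 by simp
      have "entry_key ` (?u ` l_G s) = entry_key ` l_G s" unfolding image_image ek ..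
      then have "entry_key ` l_G s1 = entry_key ` l_G s" unfolding s1 by simp
      then show "entry_key ` l_G s1 \<union> {x. x = (k, t) \<and> t \<le> l_ValClock s k} = entry_key ` l_G s \<union> {(k, t)}"
        using ack by auto
    qed (simp_all add: s1)
    then show ?thesis using h by (simp add: s1)
  next
    case new
    let ?g = "\<lparr>e_v = v, e_k = k, e_t = t, e_cl = (\<lambda>_. \<infinity>)(j := enat cc)\<rparr>"
    have nex: "\<not> (\<exists>g \<in> l_G s. e_k g = k \<and> e_t g = t)" using new(2) unfolding entry_key_def by force
    have nh: "\<not> heard S \<rho> (k, t)" using c(5)[of k t] new by auto
    have s1: "l_G s1 = insert ?g (l_G s)" "l_X s1 = l_X s" "l_ValClock s1 = l_ValClock s" "l_V s1 = l_V s"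
      using code m new(1) nex by (auto simp: Let_def split: if_splits)
    have out: "k = i \<and> ms = [] \<and> l_SendClock s1 = l_SendClock s \<or> k \<noteq> i \<and>
           ms = [Message v k t (Suc (l_SendClock s))] \<and> l_SendClock s1 = Suc (l_SendClock s)"
      using code m new(1) nex by (auto simp: Let_def split: if_splits)
    have none: "Message v' k t c' \<notin> set (take (\<rho> l) (S l))" for l v' c'
      using nh unfolding heard_def by force
    have ok: "record_ok S ?\<rho> ?g"
      using own hk none unfolding record_ok_def entry_key_def by (auto simp: tk simp del: fun_upd_apply) (auto)
    have "view_inv S ?\<rho> s1"
    proof (rule viewI)
      show "l_ValClock s (e_k g) < e_t g \<and> record_ok S ?\<rho> g" if "g \<in> l_G s1" for g
      proof (cases "g = ?g")
        case False
        then have "g \<in> l_G s" using that s1(1) by simp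
        moreover then have "entry_key g \<noteq> (k, t)" using new(2) by (metis imageI)
        ultimately show ?thesis using oth c(2) by blast
      qed (use ok new(1) in simp)
      have "entry_key ?g = (k, t)" unfolding entry_key_def by simp
      then show "inj_on entry_key (l_G s1)" "entry_key ` l_G s1 \<union> {x. x = (k, t) \<and> t \<le> l_ValClock s k} = entry_key ` l_G s \<union> {(k, t)}"
        using s1(1) new c(4) by auto
    qed (simp_all add: s1)
    then show ?thesis using s1 out nh by blast
  qed
  then show "view_inv S (\<rho>(j := Suc (\<rho> j))) s1"
    "l_V s1 = l_V s" "l_X s1 = l_X s" "l_ValClock s1 = l_ValClock s"
    "ms = [] \<and> l_SendClock s1 = l_SendClock s \<and>
           (heard S \<rho> (key (S j ! \<rho> j)) \<or> fst (key (S j ! \<rho> j)) = i) \<or>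
         (\<exists>v k t c. S j ! \<rho> j = Message v k t c \<and> k \<noteq> i \<and> \<not> heard S \<rho> (k, t) \<and>
           ms = [Message v k t (Suc (l_SendClock s))] \<and> l_SendClock s1 = Suc (l_SendClock s))"
    using m by auto
qed

section \<open>The removal loop and the validation step\<close>

lemma prune_subset: "(prune_step G)\<^sup>*\<^sup>* A B \<Longrightarrow> B \<subseteq> A"
  by (induction rule: rtranclp_induct) (auto elim: prune_step.cases)

text \<open>A member of \<open>C\<close> could be removed only because of a blocker outside the
  current set, hence outside \<open>C\<close>, and no such blocker exists. This is how liveness uses
  the loop.\<close>

lemma prune_stable:
  assumes "(prune_step G)\<^sup>*\<^sup>* A B" "C \<subseteq> A"
    "\<And>g g'. g' \<in> C \<Longrightarrow> g \<in> G - C \<Longrightarrow> majority {l. e_cl g' l < e_cl g l}"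
  shows "C \<subseteq> B"
  using assms(1)
proof (induction rule: rtranclp_induct)
  case base
  show ?case using assms(2) .
next
  case (step B B')
  from step(2) obtain g g' where "g \<in> G - B" "B' = B - {g'}" "\<not> majority {l. e_cl g' l < e_cl g l}"
    by (auto elim: prune_step.cases)
  then show ?case using step.IH assms(3)[of g' g] by blast
qed

text \<open>The last fact is the exit condition of the loop, since otherwise a further removal would
  be possible. This is how safety uses the loop.\<close>

lemma validatedD:
  assumes "validated G A"
  shows "A \<subseteq> G" "g \<in> A \<Longrightarrow> majority {l. e_cl g l < \<infinity>}"
    "g' \<in> A \<Longrightarrow> g \<in> G - A \<Longrightarrow> majority {l. e_cl g' l < e_cl g l}"
proof -
  have "A \<subseteq> {g \<in> G. majority {l. e_cl g l < \<infinity>}}"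
    using assms prune_subset unfolding validated_def by blast
  then show "A \<subseteq> G" "g \<in> A \<Longrightarrow> majority {l. e_cl g l < \<infinity>}" by auto
  show "g' \<in> A \<Longrightarrow> g \<in> G - A \<Longrightarrow> majority {l. e_cl g' l < e_cl g l}"
    using assms prune_step.intros[of g G A g'] unfolding validated_def by blast
qed

text \<open>Valid for every enumeration of the records. The last fact takes stamp and value from one
  and the same record, so the two arrays stay consistent.\<close>

lemma fold_apply_entry:
  fixes s :: "'p lstate"
  shows "l_G (fold apply_entry gs s) = l_G s" "l_V (fold apply_entry gs s) = l_V s"
    "l_SendClock (fold apply_entry gs s) = l_SendClock s"
    "l_ValClock s k \<le> l_ValClock (fold apply_entry gs s) k"
    "g \<in> set gs \<Longrightarrow> e_t g \<le> l_ValClock (fold apply_entry gs s) (e_k g)"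
    "l_ValClock (fold apply_entry gs s) k = l_ValClock s k \<and> l_X (fold apply_entry gs s) k = l_X s k \<or>
      (\<exists>g \<in> set gs. e_k g = k \<and> l_ValClock (fold apply_entry gs s) k = e_t g \<and>
         l_X (fold apply_entry gs s) k = e_v g)"
proof -
  have *: "l_G (fold apply_entry gs s) = l_G s \<and> l_V (fold apply_entry gs s) = l_V s \<and>
    l_SendClock (fold apply_entry gs s) = l_SendClock s" for gs and s :: "'p lstate"
    by (induction gs arbitrary: s) (auto simp: apply_entry_def)
  have mono: "l_ValClock s k \<le> l_ValClock (fold apply_entry gs s) k" for gs k and s :: "'p lstate"
  proof (induction gs arbitrary: s)
    case (Cons g gs)
    have "l_ValClock s k \<le> l_ValClock (apply_entry g s) k" by (auto simp: apply_entry_def)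
    then show ?case using Cons[of "apply_entry g s"] by simp
  qed simp
  have ge: "g \<in> set gs \<Longrightarrow> e_t g \<le> l_ValClock (fold apply_entry gs s) (e_k g)" for gs g and s :: "'p lstate"
  proof (induction gs arbitrary: s)
    case (Cons h gs)
    show ?case
    proof (cases "g = h")
      case True
      have "e_t g \<le> l_ValClock (apply_entry g s) (e_k g)" by (auto simp: apply_entry_def)
      then show ?thesis using mono[of "apply_entry g s" "e_k g" gs] True by simp
    next
      case False
      then show ?thesis using Cons by simp
    qed
  qed simp
  have val: "l_ValClock (fold apply_entry gs s) k = l_ValClock s k \<and> l_X (fold apply_entry gs s) k = l_X s k \<or>
      (\<exists>g \<in> set gs. e_k g = k \<and> l_ValClock (fold apply_entry gs s) k = e_t g \<and> l_X (fold apply_entry gs s) k = e_v g)"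
    for gs and s :: "'p lstate"
  proof (induction gs arbitrary: s)
    case (Cons g gs)
    show ?case using Cons[of "apply_entry g s"] by (auto simp: apply_entry_def split: if_splits)
  qed simp
  show "l_G (fold apply_entry gs s) = l_G s" "l_V (fold apply_entry gs s) = l_V s"
    "l_SendClock (fold apply_entry gs s) = l_SendClock s"
    "l_ValClock s k \<le> l_ValClock (fold apply_entry gs s) k"
    "g \<in> set gs \<Longrightarrow> e_t g \<le> l_ValClock (fold apply_entry gs s) (e_k g)"
    "l_ValClock (fold apply_entry gs s) k = l_ValClock s k \<and> l_X (fold apply_entry gs s) k = l_X s k \<or>
      (\<exists>g \<in> set gs. e_k g = k \<and> l_ValClock (fold apply_entry gs s) k = e_t g \<and>
         l_X (fold apply_entry gs s) k = e_v g)"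
    using * mono ge val by blast+
qed

lemma validate_codeE:
  assumes "validate_code s s'"
  obtains A where "validated (l_G s) A" "l_G s' = l_G s - A" "l_V s' = l_V s"
    "l_SendClock s' = l_SendClock s" "\<And>k. l_ValClock s k \<le> l_ValClock s' k"
    "\<And>g. g \<in> A \<Longrightarrow> e_t g \<le> l_ValClock s' (e_k g)"
    "\<And>k. l_ValClock s' k = l_ValClock s k \<and> l_X s' k = l_X s k \<or>
      (\<exists>g \<in> A. e_k g = k \<and> l_ValClock s' k = e_t g \<and> l_X s' k = e_v g)"
proof -
  obtain gs where gs: "validated (l_G s) (set gs)"
    "s' = fold apply_entry gs (s\<lparr>l_G := l_G s - set gs\<rparr>)"
    using assms unfolding validate_code_def by blast
  note f = fold_apply_entry[where gs = gs and s = "s\<lparr>l_G := l_G s - set gs\<rparr>", folded gs(2)]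
  show ?thesis
    by (rule that[OF gs(1)]) (use f in simp_all)
qed

lemma record_ok_less_iff:
  assumes "wf_log S" "record_ok S \<rho> g" "record_ok S \<rho> g'"
  shows "e_cl g l < e_cl g' l \<longleftrightarrow> before (take (\<rho> l) (S l)) (entry_key g) (entry_key g')"
  unfolding entry_key_def
proof (rule before_clock_iff)
  show "clocked (take (\<rho> l) (S l))"
    using assms(1) clocked_prefix[OF _ take_is_prefix] unfolding wf_log_def by blast
qed (use assms in \<open>auto simp: record_ok_def\<close>)

lemma record_ok_finite_iff:
  assumes "record_ok S \<rho> g"
  shows "e_cl g l < \<infinity> \<longleftrightarrow> entry_key g \<in> keys (take (\<rho> l) (S l))"
proof -
  have "e_cl g l < \<infinity> \<longleftrightarrow> (\<exists>c. e_cl g l = enat c)" by (cases "e_cl g l") auto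
  also have "\<dots> \<longleftrightarrow> (\<exists>c v. Message v (e_k g) (e_t g) c \<in> set (take (\<rho> l) (S l)))"
    using assms unfolding record_ok_def by blast
  also have "\<dots> \<longleftrightarrow> entry_key g \<in> keys (take (\<rho> l) (S l))"
  proof
    assume "entry_key g \<in> keys (take (\<rho> l) (S l))"
    then show "\<exists>c v. Message v (e_k g) (e_t g) c \<in> set (take (\<rho> l) (S l))"
      using keyE unfolding entry_key_def by (metis fst_conv snd_conv)
  qed (force simp: entry_key_def)
  finally show ?thesis .
qed

text \<open>The core of safety: the clause that a validated update precedes every update not
  validated is re-established from the exit condition of the loop.\<close>

lemma view_inv_validate:
  assumes wf: "wf_log S" and view_inv: "view_inv S \<rho> s" and code: "validate_code s s'"
  shows "view_inv S \<rho> s'"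
proof -
  note c = view_invD[OF view_inv]
  obtain A where A: "validated (l_G s) A" "l_G s' = l_G s - A"
    "\<And>k. l_ValClock s k \<le> l_ValClock s' k"
    "\<And>g. g \<in> A \<Longrightarrow> e_t g \<le> l_ValClock s' (e_k g)"
    "\<And>k. l_ValClock s' k = l_ValClock s k \<and> l_X s' k = l_X s k \<or>
      (\<exists>g \<in> A. e_k g = k \<and> l_ValClock s' k = e_t g \<and> l_X s' k = e_v g)"
    using validate_codeE[OF code] by metis
  note v = validatedD[OF A(1)]
  have clocked: "clocked (take (\<rho> l) (S l))" for l
    using wf clocked_prefix[OF _ take_is_prefix] unfolding wf_log_def by blast
  have ord: "before (S l) (k, t) (k, t')"
    if "(k, t') \<in> keys (S l)" "(k, t) \<in> keys (S k)" "t < t'" for l k t t'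
    using wf that unfolding wf_log_def by blast
  have own: "entry_key g \<in> keys (S (e_k g))" if "g \<in> l_G s" for g
    using c(3)[OF that] unfolding record_ok_def entry_key_def by force
  \<comment> \<open>A leftover record must not be overtaken by a validated one of the same process:
    the later update precedes the earlier one in no log, so the exit condition would ask for an
    empty majority.\<close>
  have rest: "l_ValClock s' (e_k g) < e_t g" if g: "g \<in> l_G s - A" for g
  proof (rule ccontr)
    assume "\<not> ?thesis"
    then have le: "e_t g \<le> l_ValClock s' (e_k g)" by simp
    then obtain g' where g': "g' \<in> A" "e_k g' = e_k g" "l_ValClock s' (e_k g) = e_t g'"
      using A(5)[of "e_k g"] c(2)[of g] g by auto
    have "entry_key g \<noteq> entry_key g'" using g g' v(1) c(4) by (auto dest: inj_onD)
    then have less: "e_t g < e_t g'" using le g'(2,3) unfolding entry_key_def by simp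
    have "{l. e_cl g' l < e_cl g l} = {}"
    proof (safe, rule ccontr)
      fix l assume "e_cl g' l < e_cl g l"
      then have b: "before (take (\<rho> l) (S l)) (entry_key g') (entry_key g)"
        using record_ok_less_iff[OF wf c(3) c(3)] g g'(1) v(1) by blast
      then have b': "before (S l) (entry_key g') (entry_key g)" using before_mono take_is_prefix by blast
      then have "before (S l) (entry_key g) (entry_key g')"
        using ord[of "e_k g" "e_t g'" l "e_t g"] before_sent[OF b'] own[of g] g less g'(2)
        unfolding entry_key_def by simp
      then show False using b' before_asym by blast
    qed
    then show False using v(3)[OF g'(1) g] by simp
  qed
  \<comment> \<open>By FIFO, the log that delivered the validated stamp of \<open>k\<close>
    delivered all its smaller stamps before. They have records, and \<open>rest\<close> leaves them
    no place but \<open>A\<close>.\<close>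
  have newly: "heard S \<rho> (k, t) \<and> (k, t) \<in> entry_key ` A"
    if kt: "(k, t) \<in> keys (S k)" "t \<le> l_ValClock s' k" "\<not> t \<le> l_ValClock s k" for k t
  proof -
    obtain g where g: "g \<in> A" "e_k g = k" "l_ValClock s' k = e_t g"
      using A(5)[of k] kt(2,3) by auto
    then have "heard S \<rho> (entry_key g)" using c(3) v(1) unfolding record_ok_def by blast
    then obtain l where l: "(k, e_t g) \<in> keys (take (\<rho> l) (S l))"
      using g(2) unfolding heard_def entry_key_def by auto
    have "(k, t) \<in> keys (take (\<rho> l) (S l))"
    proof (cases "t = e_t g")
      case False
      then have "t < e_t g" using kt(2) g(3) by simp
      moreover have "(k, e_t g) \<in> keys (S l)" using l by (auto dest: in_set_takeD)
      ultimately have "before (S l) (k, t) (k, e_t g)" using ord kt(1) by blast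
      then show ?thesis using before_prefix_mem(1) take_is_prefix l by blast
    qed (use l in simp)
    then have h: "heard S \<rho> (k, t)" unfolding heard_def by blast
    then have "(k, t) \<in> entry_key ` l_G s" using c(5)[OF h] kt(3) by simp
    then obtain g' where g': "g' \<in> l_G s" "entry_key g' = (k, t)" by auto
    then have "g' \<in> A" using rest[of g'] kt(2) unfolding entry_key_def by force
    then show ?thesis using h g'(2) by force
  qed
  \<comment> \<open>A competitor with a record loses by the exit condition. One that was never heard
    is in no received prefix, so the majority of finite entries is enough.\<close>
  have maj: "majority {l. before (S l) (k, t) (k', t')}"
    if kt: "(k, t) \<in> keys (S k)" "t \<le> l_ValClock s' k" "l_ValClock s' k' < t'" for k t k' t'
  proof (cases "t \<le> l_ValClock s k")
    case True
    then show ?thesis using c(7)[OF kt(1) True] A(3)[of k'] kt(3) by simp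
  next
    case False
    then obtain g where g: "g \<in> A" "entry_key g = (k, t)" using newly[OF kt(1,2)] by auto
    have ok: "record_ok S \<rho> g" using g v(1) c(3) by blast
    show ?thesis
    proof (cases "(k', t') \<in> entry_key ` l_G s")
      case True
      then obtain g' where g': "g' \<in> l_G s" "entry_key g' = (k', t')" by auto
      then have "g' \<notin> A" using A(4)[of g'] kt(3) unfolding entry_key_def by auto
      then have "majority {l. e_cl g l < e_cl g' l}" using v(3) g g' by blast
      then show ?thesis
      proof (rule majority_mono, safe)
        fix l assume "e_cl g l < e_cl g' l"
        then show "before (S l) (k, t) (k', t')"
          using record_ok_less_iff[OF wf ok c(3)[OF g'(1)]] g g' before_mono take_is_prefix by metis
      qed
    next
      case False
      then have nh: "\<not> heard S \<rho> (k', t')" using c(5)[of k' t'] A(3)[of k'] kt(3) by auto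
      have "majority {l. e_cl g l < \<infinity>}" using v(2) g by blast
      then show ?thesis
      proof (rule majority_mono, safe)
        fix l assume "e_cl g l < \<infinity>"
        then have "(k, t) \<in> keys (take (\<rho> l) (S l))" using record_ok_finite_iff[OF ok] g by simp
        then show "before (S l) (k, t) (k', t')"
          using nh take_is_prefix unfolding heard_def by (blast intro: beforeI_unsent)
      qed
    qed
  qed
  have hk: "heard S \<rho> (k, t)" if "(k, t) \<in> keys (S k)" "t \<le> l_ValClock s' k" for k t
    using newly[OF that] c(8)[OF that(1)] by blast
  have cov: "t \<le> l_ValClock s' k \<or> (k, t) \<in> entry_key ` l_G s'" if "heard S \<rho> (k, t)" for k t
  proof -
    from c(5)[OF that] consider "t \<le> l_ValClock s k" | g where "g \<in> l_G s" "entry_key g = (k, t)" by auto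
    then show ?thesis
    proof cases
      case 1
      then show ?thesis using A(3)[of k] by simp
    next
      case 2
      then show ?thesis using A(2) A(4)[of g] unfolding entry_key_def by (cases "g \<in> A") force+
    qed
  qed
  have val: "l_ValClock s' k = 0 \<and> l_X s' k = 0 \<or>
          Message (l_X s' k) k (l_ValClock s' k) (l_ValClock s' k) \<in> set (S k)" for k
    using A(5)[of k]
  proof
    assume "\<exists>g\<in>A. e_k g = k \<and> l_ValClock s' k = e_t g \<and> l_X s' k = e_v g"
    then obtain g where "g \<in> A" "e_k g = k" "l_ValClock s' k = e_t g" "l_X s' k = e_v g" by blast
    then show ?thesis using c(3)[of g] v(1) unfolding record_ok_def by auto
  qed (use c(6)[of k] in simp)
  have "inj_on entry_key (l_G s')" unfolding A(2) using c(4) inj_on_subset by blast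
  then show ?thesis unfolding view_inv_def
    using c(1) rest c(3) cov val maj hk A(2) by blast
qed

text \<open>The records with keys in \<open>D\<close> form a set that the loop cannot touch. Members
  of \<open>D\<close> without a record were validated earlier.\<close>

lemma stable_validated:
  assumes wf: "wf_log S" and view_inv: "view_inv S \<rho> s" and code: "validate_code s s'"
    and heard: "\<And>m. m \<in> D \<Longrightarrow> majority {l. m \<in> keys (take (\<rho> l) (S l))}"
    and stable: "\<And>m m'. m \<in> D \<Longrightarrow> m' \<notin> D \<Longrightarrow> m' \<in> entry_key ` l_G s \<Longrightarrow>
      majority {l. before (take (\<rho> l) (S l)) m m'}"
    and kt: "(k, t) \<in> D"
  shows "t \<le> l_ValClock s' k"
proof -
  note c = view_invD[OF view_inv]
  obtain A where A: "validated (l_G s) A"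
    "\<And>k. l_ValClock s k \<le> l_ValClock s' k"
    "\<And>g. g \<in> A \<Longrightarrow> e_t g \<le> l_ValClock s' (e_k g)"
    using validate_codeE[OF code] by metis
  let ?C = "{g \<in> l_G s. entry_key g \<in> D}"
  have "?C \<subseteq> A"
  proof (rule prune_stable)
    show "(prune_step (l_G s))\<^sup>*\<^sup>* {g \<in> l_G s. majority {l. e_cl g l < \<infinity>}} A"
      using A(1) unfolding validated_def by blast
    have "majority {l. e_cl g l < \<infinity>}" if "g \<in> ?C" for g
      using heard[of "entry_key g"] record_ok_finite_iff[OF c(3)[of g]] that by simp
    then show "?C \<subseteq> {g \<in> l_G s. majority {l. e_cl g l < \<infinity>}}" by blast
    show "majority {l. e_cl g' l < e_cl g l}" if "g' \<in> ?C" "g \<in> l_G s - ?C" for g g'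
      using stable[of "entry_key g'" "entry_key g"] record_ok_less_iff[OF wf c(3)[of g'] c(3)[of g]] that by simp
  qed
  moreover obtain l where "(k, t) \<in> keys (take (\<rho> l) (S l))"
    using heard[OF kt] not_majority_empty by (metis (mono_tags, lifting) empty_Collect_eq)
  then have "t \<le> l_ValClock s k \<or> (k, t) \<in> entry_key ` l_G s" using c(5) unfolding heard_def by blast
  ultimately show ?thesis
  proof (elim disjE)
    assume "(k, t) \<in> entry_key ` l_G s" "?C \<subseteq> A"
    then obtain g where "g \<in> A" "entry_key g = (k, t)" using kt by auto
    then show ?thesis using A(3)[of g] unfolding entry_key_def by simp
  qed (use A(2)[of k] in simp)
qed

text \<open>The fourth conjunct is the purpose of postponing: a process launches an update only
  after validating its previous ones. The last one closes a gap in the test \<open>no_own\<close>,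
  which also succeeds while an own message is still on its way and has no record; no such message
  exists while a value is postponed.\<close>

definition sender_inv :: "('p::finite \<Rightarrow> 'p message list) \<Rightarrow> 'p \<Rightarrow> ('p \<Rightarrow> nat) \<Rightarrow> 'p lstate \<Rightarrow> bool" where
  "sender_inv S i \<rho> s \<longleftrightarrow>
     l_SendClock s = length (S i) \<and>
     (\<forall>m. heard S \<rho> m \<longrightarrow> m \<in> keys (S i)) \<and>
     (\<forall>k t. (k, t) \<in> keys (S i) \<longrightarrow> k \<noteq> i \<longrightarrow> heard S \<rho> (k, t)) \<and>
     (\<forall>t t'. (i, t) \<in> keys (S i) \<longrightarrow> (i, t') \<in> keys (S i) \<longrightarrow> t < t' \<longrightarrow> t \<le> l_ValClock s i) \<and>
     (l_V s \<noteq> None \<longrightarrow> (\<forall>t. (i, t) \<notin> keys (drop (\<rho> i) (S i))))"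

definition proc_inv :: "('p::finite \<Rightarrow> 'p message list) \<Rightarrow> 'p \<Rightarrow> ('p \<Rightarrow> nat) \<Rightarrow> 'p lstate \<Rightarrow> bool" where
  "proc_inv S i \<rho> s \<longleftrightarrow> view_inv S \<rho> s \<and> sender_inv S i \<rho> s \<and> (l_V s \<noteq> None \<longrightarrow> \<not> no_own i s)"

lemma sender_invD:
  assumes "sender_inv S i \<rho> s"
  shows "l_SendClock s = length (S i)" "heard S \<rho> m \<Longrightarrow> m \<in> keys (S i)"
    "(k, t) \<in> keys (S i) \<Longrightarrow> k \<noteq> i \<Longrightarrow> heard S \<rho> (k, t)"
    "(i, t) \<in> keys (S i) \<Longrightarrow> (i, t') \<in> keys (S i) \<Longrightarrow> t < t' \<Longrightarrow> t \<le> l_ValClock s i"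
    "l_V s \<noteq> None \<Longrightarrow> (i, t) \<notin> keys (drop (\<rho> i) (S i))"
  using assms unfolding sender_inv_def by blast+

lemma heard_mono_eq:
  assumes "\<And>l. \<rho> l \<le> length (S l)" "\<And>l. prefix (S l) (S' l)"
  shows "heard S' \<rho> = heard S \<rho>"
  unfolding heard_def take_prefix_eq[OF assms(2,1)] ..

lemma proc_inv_mono:
  assumes "proc_inv S i \<rho> s" "wf_log S'" "\<And>l. prefix (S l) (S' l)" "S' i = S i"
  shows "proc_inv S' i \<rho> s"
proof -
  have c: "view_inv S \<rho> s" using assms(1) unfolding proc_inv_def by blast
  have hd: "heard S' \<rho> = heard S \<rho>" using heard_mono_eq[OF view_invD(1)[OF c] assms(3)] .
  show ?thesis
    using assms(1) view_inv_mono[OF c assms(2,3)] unfolding proc_inv_def sender_inv_def assms(4) hd by blast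
qed

lemma own_heard:
  assumes view_inv: "view_inv S \<rho> s" and no: "no_own i s"
    and key: "(i, t) \<in> keys (S i)" and drop: "(i, t) \<notin> keys (drop (\<rho> i) (S i))"
  shows "t \<le> l_ValClock s i"
proof -
  have "set (S i) = set (take (\<rho> i) (S i)) \<union> set (drop (\<rho> i) (S i))"
    by (metis append_take_drop_id set_append)
  then have "heard S \<rho> (i, t)" using key drop unfolding heard_def by (metis Un_iff image_Un)
  then show ?thesis using view_invD(5)[OF view_inv] no unfolding no_own_def entry_key_def by force
qed

text \<open>Common to direct and postponed updates, hence the final reset of \<open>l_V\<close>,
  which in the direct case is \<open>None\<close> anyway.\<close>

lemma launch:
  assumes wf: "wf_log S" and view_inv: "view_inv S \<rho> s" and sender_inv: "sender_inv S i \<rho> s"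
    and no: "no_own i s" and drop: "\<And>t. (i, t) \<notin> keys (drop (\<rho> i) (S i))"
    and send: "send_own i v s = (s', ms)"
  shows "wf_log (S(i := S i @ ms))" "proc_inv (S(i := S i @ ms)) i \<rho> (s'\<lparr>l_V := None\<rparr>)"
    "ms = [Message v i (Suc (length (S i))) (Suc (length (S i)))]"
proof -
  note c = view_invD[OF view_inv] and d = sender_invD[OF sender_inv]
  let ?n = "Suc (length (S i))"
  have ms: "ms = [Message v i ?n ?n]"
    and s': "s' = s\<lparr>l_SendClock := ?n\<rparr>"
    using send d(1) unfolding send_own_def by (auto simp: Let_def)
  from ms show "ms = [Message v i ?n ?n]" .
  have new: "(i, ?n) \<notin> keys (S i)"
    using wf_log_own[OF wf, of i ?n i] by (metis not_less_eq_eq order_refl)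
  show wf': "wf_log (S(i := S i @ ms))" (is "wf_log ?S")
    unfolding ms by (rule wf_log_append) (use wf new in auto)
  have pre: "prefix (S l) (?S l)" for l by simp
  have view_inv': "view_inv ?S \<rho> (s'\<lparr>l_V := None\<rparr>)"
    using view_inv_mono[OF view_inv wf' pre] by (rule view_inv_cong[THEN iffD2, rotated -1]) (simp_all add: s')
  have hd: "heard ?S \<rho> = heard S \<rho>" using heard_mono_eq[OF c(1) pre] .
  have keys: "keys (?S i) = insert (i, ?n) (keys (S i))" by (auto simp: ms)
  have val: "t \<le> l_ValClock s i" if "(i, t) \<in> keys (S i)" for t
    using own_heard[OF view_inv no that drop] .
  have le: "t < ?n" if "(i, t) \<in> keys (S i)" for t
    using wf_log_own[OF wf that] by (metis le_imp_less_Suc)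
  have "sender_inv ?S i \<rho> (s'\<lparr>l_V := None\<rparr>)"
    unfolding sender_inv_def hd keys using d(2,3) val le by (fastforce simp: s' ms)
  then show "proc_inv ?S i \<rho> (s'\<lparr>l_V := None\<rparr>)" unfolding proc_inv_def using view_inv' by simp
qed

lemma sender_inv_receive:
  assumes wf: "wf_log S" and view_inv: "view_inv S \<rho> s" and sender_inv: "sender_inv S i \<rho> s"
    and \<rho>: "\<rho> j < length (S j)" and code: "record_code i j (S j ! \<rho> j) s = (s1, ms)"
  defines "S1 \<equiv> S(i := S i @ ms)" and "\<rho>1 \<equiv> \<rho>(j := Suc (\<rho> j))"
  shows "wf_log S1" "view_inv S1 \<rho>1 s1" "sender_inv S1 i \<rho>1 s1"
proof -
  note c = view_invD[OF view_inv] and d = sender_invD[OF sender_inv]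
  note r = view_inv_receive[OF wf view_inv \<rho> code]
  obtain v k t cc where m: "S j ! \<rho> j = Message v k t cc" using message.exhaust by blast
  have mem: "Message v k t cc \<in> set (S j)" using \<rho> m by (metis nth_mem)
  have own: "Message v k t t \<in> set (S k)" using mem wf unfolding wf_log_def by blast
  have hd1: "heard S \<rho>1 x \<longleftrightarrow> heard S \<rho> x \<or> x = (k, t)" for x
    using heard_received[of \<rho> j S x] \<rho> m unfolding \<rho>1_def by simp
  have len: "\<rho>1 l \<le> length (S l)" for l using c(1)[of l] \<rho> unfolding \<rho>1_def by simp
  have pre: "prefix (S l) (S1 l)" for l unfolding S1_def by simp
  have hd: "heard S1 \<rho>1 x \<longleftrightarrow> heard S \<rho> x \<or> x = (k, t)" for x
    using heard_mono_eq[OF len pre] hd1 by simp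
  consider (silent) "ms = []" "l_SendClock s1 = l_SendClock s" "heard S \<rho> (k, t) \<or> k = i"
    | (fwd) "k \<noteq> i" "\<not> heard S \<rho> (k, t)" "ms = [Message v k t (Suc (length (S i)))]"
      "l_SendClock s1 = Suc (length (S i))"
    using r(5) m d(1) by auto
  then have "wf_log S1 \<and> l_SendClock s1 = length (S1 i) \<and> keys (S1 i) = insert (k, t) (keys (S i)) \<and>
      (\<forall>t. (i, t) \<in> keys ms \<longrightarrow> False)"
  proof cases
    case silent
    \<comment> \<open>Nothing is sent either because the update was heard, hence logged, earlier or
      because it is the process's own message coming back.\<close>
    have "(k, t) \<in> keys (S i)" using silent(3) d(2) own by force
    then show ?thesis using silent d(1) wf unfolding S1_def by (auto simp: fun_upd_idem)
  next
    case fwd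
    have new: "(k, t) \<notin> keys (S i)" using d(3) fwd(1,2) by blast
    \<comment> \<open>FIFO again: \<open>j\<close> logged \<open>(k, t0)\<close> before
      \<open>(k, t)\<close>, so it was received from \<open>j\<close> earlier and is in the log of
      \<open>i\<close>.\<close>
    have "(k, t0) \<in> keys (S i)" if "(k, t0) \<in> keys (S k)" "t0 < t" for t0
    proof -
      have "(k, t) \<in> keys (S j)" using mem by force
      then have b: "before (S j) (k, t0) (k, t)" using wf that unfolding wf_log_def by blast
      have tk: "take (Suc (\<rho> j)) (S j) = take (\<rho> j) (S j) @ [Message v k t cc]"
        using \<rho> m by (simp add: take_Suc_conv_app_nth)
      have "(k, t0) \<in> keys (take (Suc (\<rho> j)) (S j))"
        by (rule before_prefix_mem(1)[OF b take_is_prefix]) (simp add: tk)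
      then have "heard S \<rho> (k, t0)" using that(2) unfolding heard_def tk by auto
      then show ?thesis using d(2) by blast
    qed
    then have "wf_log S1" unfolding S1_def fwd(3)
      by (intro wf_log_append) (use wf new fwd own in auto)
    then show ?thesis using fwd unfolding S1_def by auto
  qed
  then have wf1: "wf_log S1" and sc: "l_SendClock s1 = length (S1 i)"
    and ks: "keys (S1 i) = insert (k, t) (keys (S i))" and ms: "\<And>t. (i, t) \<notin> keys ms" by auto
  show "wf_log S1" by (fact wf1)
  show "view_inv S1 \<rho>1 s1" using view_inv_mono[OF r(1) wf1] pre unfolding \<rho>1_def by blast
  have 1: "heard S1 \<rho>1 x \<longrightarrow> x \<in> keys (S1 i)" for x unfolding hd ks using d(2) by auto
  have 2: "(k', t') \<in> keys (S1 i) \<longrightarrow> k' \<noteq> i \<longrightarrow> heard S1 \<rho>1 (k', t')" for k' t'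
    unfolding hd ks using d(3) by auto
  have own': "(i, t') \<in> keys (S1 i) \<longleftrightarrow> (i, t') \<in> keys (S i)" for t'
    using ms[of t'] unfolding S1_def by auto
  have 3: "(i, t) \<notin> keys (drop (\<rho>1 i) (S1 i))" if "l_V s1 \<noteq> None" for t
  proof -
    have "drop (\<rho>1 i) (S1 i) = drop (\<rho>1 i) (S i) @ ms" using len[of i] unfolding S1_def by simp
    moreover have "set (drop (\<rho>1 i) (S i)) \<subseteq> set (drop (\<rho> i) (S i))"
      unfolding \<rho>1_def by (simp add: set_drop_subset_set_drop)
    ultimately show ?thesis using d(5)[of t] that r(2) ms[of t] by auto
  qed
  show "sender_inv S1 i \<rho>1 s1" unfolding sender_inv_def own' r(4) using sc 1 2 3 d(4) by blast
qed

lemma sender_inv_validate: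
  assumes "sender_inv S i \<rho> s" "validate_code s s'"
  shows "sender_inv S i \<rho> s'"
proof -
  obtain A where "l_V s' = l_V s" "l_SendClock s' = l_SendClock s"
    "\<And>k. l_ValClock s k \<le> l_ValClock s' k"
    using validate_codeE[OF assms(2)] by metis
  note v = this and d = sender_invD[OF assms(1)]
  have "t \<le> l_ValClock s' i" if "(i, t) \<in> keys (S i)" "(i, t') \<in> keys (S i)" "t < t'" for t t'
    using d(4)[OF that] v(3)[of i] by (rule le_trans)
  then show ?thesis unfolding sender_inv_def v(1,2) using d(1,2,3,5) by blast
qed

text \<open>The facts on \<open>l_V\<close> say that a handler keeps the postponed value or launches
  exactly that value as its last message; later they connect messages with update
  operations.\<close>

lemma proc_inv_handler:
  assumes wf: "wf_log S" and proc_inv: "proc_inv S i \<rho> s"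
    and \<rho>: "\<rho> j < length (S j)" and h: "handler i j (S j ! \<rho> j) s s' ms"
  shows "wf_log (S(i := S i @ ms))" "proc_inv (S(i := S i @ ms)) i (\<rho>(j := Suc (\<rho> j))) s'"
    "l_V s' = l_V s \<or> l_V s' = None \<and> (\<exists>v. l_V s = Some v \<and>
       (\<exists>ms1. ms = ms1 @ [Message v i (length (S i @ ms)) (length (S i @ ms))]))"
    "\<And>v t c. Message v i t c \<in> set ms \<Longrightarrow> l_V s = Some v \<and> l_V s' = None"
    "l_ValClock s k \<le> l_ValClock s' k"
proof -
  obtain s1 ms1 s2 ms2 where code: "record_code i j (S j ! \<rho> j) s = (s1, ms1)"
    "validate_code s1 s2" "flush_code i s2 = (s', ms2)" "ms = ms1 @ ms2"
    using h unfolding handler_def by blast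
  have view_inv: "view_inv S \<rho> s" and sender_inv: "sender_inv S i \<rho> s" using proc_inv unfolding proc_inv_def by auto
  let ?S = "S(i := S i @ ms1)" let ?\<rho> = "\<rho>(j := Suc (\<rho> j))"
  note r = sender_inv_receive[OF wf view_inv sender_inv \<rho> code(1)] and r' = view_inv_receive[OF wf view_inv \<rho> code(1)]
  have ms1: "Message v i t c \<notin> set ms1" for v t c using r'(5) by auto
  have core2: "view_inv ?S ?\<rho> s2" using view_inv_validate[OF r(1,2) code(2)] .
  have inv2: "sender_inv ?S i ?\<rho> s2" using sender_inv_validate[OF r(3) code(2)] .
  have V2: "l_V s2 = l_V s" using validate_codeE[OF code(2)] r'(2) by metis
  have le2: "l_ValClock s k \<le> l_ValClock s2 k" for k using validate_codeE[OF code(2)] r'(4) by metis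
  consider (keep) "l_V s2 = None \<or> \<not> no_own i s2" "s' = s2" "ms2 = []"
    | (flush) v s3 where "l_V s2 = Some v" "no_own i s2" "send_own i v s2 = (s3, ms2)" "s' = s3\<lparr>l_V := None\<rparr>"
    using code(3) unfolding flush_code_def by (auto split: option.splits if_splits prod.splits)
  then have "wf_log (S(i := S i @ ms)) \<and> proc_inv (S(i := S i @ ms)) i ?\<rho> s' \<and>
    (l_V s' = l_V s \<or> l_V s' = None \<and> (\<exists>v. l_V s = Some v \<and>
       (\<exists>ms1. ms = ms1 @ [Message v i (length (S i @ ms)) (length (S i @ ms))]))) \<and>
    (\<forall>v t c. Message v i t c \<in> set ms \<longrightarrow> l_V s = Some v \<and> l_V s' = None) \<and>
    (\<forall>k. l_ValClock s k \<le> l_ValClock s' k)"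
  proof cases
    case keep
    then show ?thesis using r(1) core2 inv2 V2 ms1 le2 code(4) unfolding proc_inv_def by auto
  next
    case flush
    have drop: "(i, t) \<notin> keys (drop (?\<rho> i) (?S i))" for t
      using sender_invD(5)[OF inv2] flush(1) by blast
    note l = launch[OF r(1) core2 inv2 flush(2) drop flush(3)]
    have eq: "?S(i := ?S i @ ms2) = S(i := S i @ ms)" unfolding code(4) by simp
    have "l_ValClock s' = l_ValClock s2"
      using flush(3,4) unfolding send_own_def by (auto simp: Let_def)
    moreover have "proc_inv (S(i := S i @ ms)) i ?\<rho> s'" using l(2) unfolding eq flush(4) .
    moreover have "wf_log (S(i := S i @ ms))" using l(1) unfolding eq .
    moreover have "ms2 = [Message v i (length (S i @ ms)) (length (S i @ ms))]"
      using l(3) unfolding code(4) by simp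
    moreover have "l_V s = Some v" "l_V s' = None" using flush(1,4) V2 by auto
    moreover have "l_V s = Some v \<and> l_V s' = None" if "Message v i t c \<in> set ms" for v t c
    proof -
      have "Message v i t c \<in> set ms2" using that ms1 code(4) by auto
      then show ?thesis using l(3) flush(1,4) V2 by auto
    qed
    moreover have "l_ValClock s k \<le> l_ValClock s' k" for k
      using le2[of k] \<open>l_ValClock s' = l_ValClock s2\<close> by simp
    ultimately show ?thesis using code(4) by blast
  qed
  then show "wf_log (S(i := S i @ ms))" "proc_inv (S(i := S i @ ms)) i (\<rho>(j := Suc (\<rho> j))) s'"
    "l_V s' = l_V s \<or> l_V s' = None \<and> (\<exists>v. l_V s = Some v \<and>
       (\<exists>ms1. ms = ms1 @ [Message v i (length (S i @ ms)) (length (S i @ ms))]))"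
    "\<And>v t c. Message v i t c \<in> set ms \<Longrightarrow> l_V s = Some v \<and> l_V s' = None"
    "l_ValClock s k \<le> l_ValClock s' k"
    by blast+
qed

text \<open>Exposes the state between (A) and (B), over the logs as they are before the handler
  sends anything. This is the state on which the removal loop runs.\<close>

lemma handler_view:
  assumes wf: "wf_log S" and proc_inv: "proc_inv S i \<rho> s"
    and \<rho>: "\<rho> j < length (S j)" and h: "handler i j (S j ! \<rho> j) s s' ms"
  obtains s1 s2 where "view_inv S (\<rho>(j := Suc (\<rho> j))) s1" "validate_code s1 s2"
    "l_ValClock s' = l_ValClock s2"
proof -
  obtain s1 ms1 s2 ms2 where code: "record_code i j (S j ! \<rho> j) s = (s1, ms1)"
    "validate_code s1 s2" "flush_code i s2 = (s', ms2)"
    using h unfolding handler_def by blast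
  have view_inv: "view_inv S \<rho> s" using proc_inv unfolding proc_inv_def by auto
  have "l_ValClock s' = l_ValClock s2"
    using code(3) unfolding flush_code_def send_own_def
    by (auto simp: Let_def split: option.splits if_splits)
  then show ?thesis using that view_inv_receive(1)[OF wf view_inv \<rho> code(1)] code(2) by blast
qed

lemma proc_inv_update:
  assumes wf: "wf_log S" and proc_inv: "proc_inv S i \<rho> s" and \<rho>: "\<rho> i = length (S i)"
    and code: "update_code i v s = (s', ms)"
  shows "wf_log (S(i := S i @ ms))" "proc_inv (S(i := S i @ ms)) i \<rho> s'"
    "l_V s' = Some v \<and> ms = [] \<or>
     l_V s' = None \<and> ms = [Message v i (Suc (length (S i))) (Suc (length (S i)))]"
    "l_ValClock s' = l_ValClock s"
proof -
  have view_inv: "view_inv S \<rho> s" and sender_inv: "sender_inv S i \<rho> s" using proc_inv unfolding proc_inv_def by auto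
  have "wf_log (S(i := S i @ ms)) \<and> proc_inv (S(i := S i @ ms)) i \<rho> s' \<and>
    (l_V s' = Some v \<and> ms = [] \<or>
     l_V s' = None \<and> ms = [Message v i (Suc (length (S i))) (Suc (length (S i)))]) \<and>
    l_ValClock s' = l_ValClock s"
  proof (cases "no_own i s")
    case True
    then have V: "l_V s = None" using proc_inv unfolding proc_inv_def by blast
    have send: "send_own i v s = (s', ms)" using code True unfolding update_code_def by simp
    have s': "s'\<lparr>l_V := None\<rparr> = s'" "l_V s' = None" "l_ValClock s' = l_ValClock s"
      using send V unfolding send_own_def by (auto simp: Let_def)
    have "(i, t) \<notin> keys (drop (\<rho> i) (S i))" for t using \<rho> by simp
    from launch[OF wf view_inv sender_inv True this send] show ?thesis using s' by simp
  next
    case False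
    then have s': "s' = s\<lparr>l_V := Some v\<rparr>" "ms = []" using code unfolding update_code_def by auto
    have "view_inv S \<rho> s'" using view_inv by (rule view_inv_cong[THEN iffD2, rotated -1]) (simp_all add: s')
    moreover have "sender_inv S i \<rho> s'" using sender_inv \<rho> unfolding sender_inv_def s' by simp
    moreover have "\<not> no_own i s'" using False unfolding no_own_def s' by simp
    ultimately show ?thesis using wf s' unfolding proc_inv_def by simp
  qed
  then show "wf_log (S(i := S i @ ms))" "proc_inv (S(i := S i @ ms)) i \<rho> s'"
    "l_V s' = Some v \<and> ms = [] \<or>
     l_V s' = None \<and> ms = [Message v i (Suc (length (S i))) (Suc (length (S i)))]"
    "l_ValClock s' = l_ValClock s" by blast+
qed

section \<open>Logged runs\<close>

type_synonym 'p logged =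
  "('p \<Rightarrow> 'p lstate) \<times> ('p \<Rightarrow> 'p message list) \<times> ('p \<Rightarrow> 'p \<Rightarrow> nat)"

text \<open>The logged run ignores that a crash can interrupt a piece of code: the local state is updated and
  all messages are logged also in this case. The crashed process takes no further step, and the missing
  messages remain in the log without ever being received. The last component of a state counts the
  messages that \<open>i\<close> has received from \<open>j\<close>.\<close>

inductive lstep :: "'p::finite set \<Rightarrow> 'p action \<Rightarrow> 'p logged \<Rightarrow> 'p logged \<Rightarrow> bool" where
  update: "a = Do_Update i v \<or> a = Do_Update_Crash i v \<Longrightarrow> i \<notin> K \<Longrightarrow> r i i = length (S i) \<Longrightarrow>
    update_code i v (L i) = (s, ms) \<Longrightarrow> lstep K a (L, S, r) (L(i := s), S(i := S i @ ms), r)"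
| receive: "a = Receive i j \<or> a = Receive_Crash i j \<Longrightarrow> i \<notin> K \<Longrightarrow> r i j < length (S j) \<Longrightarrow>
    handler i j (S j ! r i j) (L i) s ms \<Longrightarrow>
    lstep K a (L, S, r) (L(i := s), S(i := S i @ ms), r(i := (r i)(j := Suc (r i j))))"
| idle: "(\<And>i v. a \<noteq> Do_Update i v \<and> a \<noteq> Do_Update_Crash i v) \<Longrightarrow>
    (\<And>i j. a \<noteq> Receive i j \<and> a \<noteq> Receive_Crash i j) \<Longrightarrow> lstep K a \<sigma> \<sigma>"

text \<open>For a crashed sender only a prefix of the outstanding log need be on the channel, as its
  last broadcast may have been cut. The logged state of a crashed process is unconstrained, since it
  may include the interrupted code.\<close>

definition logs :: "'p config \<Rightarrow> 'p logged \<Rightarrow> bool" where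
  "logs c = (\<lambda>(L, S, r).
     (\<forall>i. i \<notin> c_crashed c \<longrightarrow> L i = c_local c i) \<and>
     (\<forall>i j. r i j \<le> length (S j) \<and> prefix (c_chan c j i) (drop (r i j) (S j)) \<and>
        (j \<notin> c_crashed c \<longrightarrow> c_chan c j i = drop (r i j) (S j))))"

text \<open>Received plus pending messages count everything ever put on a channel. That this number
  never decreases is kept for the delivery argument.\<close>

lemma logs_step:
  assumes "step c a c'" "logs c (L, S, r)"
  shows "\<exists>L' S' r'. lstep (c_crashed c) a (L, S, r) (L', S', r') \<and> logs c' (L', S', r') \<and>
    (\<forall>i j. r i j + length (c_chan c j i) \<le> r' i j + length (c_chan c' j i))"
proof -
  have L: "L i = c_local c i" if "i \<notin> c_crashed c" for i using assms(2) that unfolding logs_def by auto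
  have r: "r i j \<le> length (S j)" for i j using assms(2) unfolding logs_def by auto
  have pre: "prefix (c_chan c j i) (drop (r i j) (S j))" for i j using assms(2) unfolding logs_def by auto
  have full: "c_chan c j i = drop (r i j) (S j)" if "j \<notin> c_crashed c" for i j
    using assms(2) that unfolding logs_def by auto
  have free: "r i i = length (S i)" if "free c i" for i
    using full[of i i] r[of i i] that unfolding free_def by simp
  have recv: "r i j < length (S j)" "hd (c_chan c j i) = S j ! r i j"
      "i \<notin> c_crashed c" "c_chan c j i \<noteq> []" if "can_receive c i j" for i j
  proof -
    show ne: "i \<notin> c_crashed c" "c_chan c j i \<noteq> []" using that unfolding can_receive_def by auto
    then have "drop (r i j) (S j) \<noteq> []" "hd (c_chan c j i) = hd (drop (r i j) (S j))"
      using pre[of j i] by (auto simp: prefix_def)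
    then show "r i j < length (S j)" "hd (c_chan c j i) = S j ! r i j" by (auto simp: hd_drop_conv_nth)
  qed
  have pre': "prefix (c_chan c j i @ take n ms) (drop (r i j) (S j @ ms))" if "j \<notin> c_crashed c" for i j n ms
    using full[OF that, of i] r[of i j] by (simp add: take_is_prefix)
  have pop: "prefix (tl (c_chan c j i)) (drop (Suc (r i j)) (S j))"
    "j \<notin> c_crashed c \<Longrightarrow> tl (c_chan c j i) = drop (Suc (r i j)) (S j)" if "c_chan c j i \<noteq> []" for i j
  proof -
    show "prefix (tl (c_chan c j i)) (drop (Suc (r i j)) (S j))"
      using pre[of j i] that by (auto simp: prefix_def drop_Suc simp flip: tl_drop)
    show "j \<notin> c_crashed c \<Longrightarrow> tl (c_chan c j i) = drop (Suc (r i j)) (S j)"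
      using full[of j i] by (simp add: drop_Suc tl_drop)
  qed
  from assms(1) show ?thesis
  proof cases
    case (update i v s ms)
    have i: "i \<notin> c_crashed c" using update(3) unfolding free_def by simp
    have "lstep (c_crashed c) a (L, S, r) (L(i := s), S(i := S i @ ms), r)"
      by (rule lstep.update) (use update i L free in auto)
    moreover have "logs c' (L(i := s), S(i := S i @ ms), r)"
      using L r pre full i by (auto simp: update(2) logs_def send_def le_SucI trans_le_add1)
    ultimately show ?thesis by (intro exI conjI) (auto simp: update(2) send_def)
  next
    case (update_crash i v s ms out)
    have i: "i \<notin> c_crashed c" using update_crash(3) unfolding free_def by simp
    obtain n where out: "\<And>j. out j = take (n j) ms"
      using update_crash(6) unfolding cut_broadcast_def by metis
    have "lstep (c_crashed c) a (L, S, r) (L(i := s), S(i := S i @ ms), r)"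
      by (rule lstep.update) (use update_crash i L free in auto)
    moreover have "logs c' (L(i := s), S(i := S i @ ms), r)"
      using L r pre full i pre'[OF i] by (auto simp: update_crash(2) logs_def send_def out trans_le_add1)
    ultimately show ?thesis by (intro exI conjI) (auto simp: update_crash(2) send_def)
  next
    case (receive i j s ms)
    note R = recv[OF receive(3)]
    have "lstep (c_crashed c) a (L, S, r) (L(i := s), S(i := S i @ ms), r(i := (r i)(j := Suc (r i j))))"
      by (rule lstep.receive) (use receive R L in auto)
    moreover have "logs c' (L(i := s), S(i := S i @ ms), r(i := (r i)(j := Suc (r i j))))"
      using L r pre full R(1,3) pop[OF R(4)]
      by (auto simp: receive(2) logs_def send_def pop_def trans_le_add1 Suc_le_eq)
    ultimately show ?thesis using R(4) by (intro exI conjI) (auto simp: receive(2) send_def pop_def)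
  next
    case (receive_crash i j s ms out)
    note R = recv[OF receive_crash(3)]
    obtain n where out: "\<And>j. out j = take (n j) ms"
      using receive_crash(5) unfolding cut_broadcast_def by metis
    have "lstep (c_crashed c) a (L, S, r) (L(i := s), S(i := S i @ ms), r(i := (r i)(j := Suc (r i j))))"
      by (rule lstep.receive) (use receive_crash R L in auto)
    moreover have "logs c' (L(i := s), S(i := S i @ ms), r(i := (r i)(j := Suc (r i j))))"
      using L r pre full R(1,3) pop[OF R(4)] pre'[OF R(3)]
      by (auto simp: receive_crash(2) logs_def send_def pop_def trans_le_add1 Suc_le_eq out take_is_prefix)
    ultimately show ?thesis using R(4) by (intro exI conjI) (auto simp: receive_crash(2) send_def pop_def)
  next
    case (call_snapshot i)
    then show ?thesis using assms(2) by (intro exI conjI, rule_tac lstep.idle) (auto simp: logs_def)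
  next
    case (return_snapshot i)
    then show ?thesis using assms(2) by (intro exI conjI, rule_tac lstep.idle) (auto simp: logs_def)
  next
    case (crash i)
    then show ?thesis using assms(2) by (intro exI conjI, rule_tac lstep.idle) (auto simp: logs_def)
  next
    case stutter
    then show ?thesis using assms(2) by (intro exI conjI, rule_tac lstep.idle) (auto simp: logs_def)
  qed
qed

locale run =
  fixes E :: "'p::finite execution"
    and L :: "nat \<Rightarrow> 'p \<Rightarrow> 'p lstate" and S :: "nat \<Rightarrow> 'p \<Rightarrow> 'p message list"
    and r :: "nat \<Rightarrow> 'p \<Rightarrow> 'p \<Rightarrow> nat"
  assumes admissible: "admissible E"
    and init: "L 0 = (\<lambda>_. init_lstate)" "S 0 = (\<lambda>_. [])" "r 0 = (\<lambda>_ _. 0)"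
    and lstep: "\<And>t. lstep (c_crashed (conf E t)) (act E t) (L t, S t, r t) (L (Suc t), S (Suc t), r (Suc t))"
    and logs: "\<And>t. logs (conf E t) (L t, S t, r t)"
    and pending: "\<And>t i j. r t i j + length (c_chan (conf E t) j i)
      \<le> r (Suc t) i j + length (c_chan (conf E (Suc t)) j i)"

text \<open>A step may have several logged counterparts, because a configuration does not record
  what an interrupted handler would have computed. The logs are thus picked along the execution by
  dependent choice.\<close>

lemma admissible_run:
  assumes "admissible E"
  obtains L S r where "run E L S r"
proof -
  have st: "step (conf E t) (act E t) (conf E (Suc t))" for t
    using assms unfolding admissible_def by blast
  have 0: "conf E 0 = init_config" using assms unfolding admissible_def by blast
  define R where "R t \<sigma> \<sigma>' \<longleftrightarrow> lstep (c_crashed (conf E t)) (act E t) \<sigma> \<sigma>' \<and>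
     (\<forall>i j. snd (snd \<sigma>) i j + length (c_chan (conf E t) j i)
       \<le> snd (snd \<sigma>') i j + length (c_chan (conf E (Suc t)) j i))" for t and \<sigma> \<sigma>' :: "'a logged"
  have "\<exists>f. \<forall>t. logs (conf E t) (f t) \<and> (t = 0 \<longrightarrow> f t = (\<lambda>_. init_lstate, \<lambda>_. [], \<lambda>_ _. 0)) \<and> R t (f t) (f (Suc t))"
  proof -
    have "\<exists>f. \<forall>t. (logs (conf E t) (f t) \<and> (t = 0 \<longrightarrow> f t = (\<lambda>_. init_lstate, \<lambda>_. [], \<lambda>_ _. 0))) \<and> R t (f t) (f (Suc t))"
    proof (rule dependent_nat_choice)
      show "\<exists>\<sigma>. logs (conf E 0) \<sigma> \<and> (0 = (0::nat) \<longrightarrow> \<sigma> = (\<lambda>_. init_lstate, \<lambda>_. [], \<lambda>_ _. 0))"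
        by (auto simp: logs_def 0 init_config_def)
    next
      fix \<sigma> t assume "logs (conf E t) \<sigma> \<and> (t = 0 \<longrightarrow> \<sigma> = (\<lambda>_. init_lstate, \<lambda>_. [], \<lambda>_ _. 0))"
      then have "logs (conf E t) (fst \<sigma>, fst (snd \<sigma>), snd (snd \<sigma>))" by simp
      from logs_step[OF st this]
      show "\<exists>\<sigma>'. (logs (conf E (Suc t)) \<sigma>' \<and> (Suc t = 0 \<longrightarrow> \<sigma>' = (\<lambda>_. init_lstate, \<lambda>_. [], \<lambda>_ _. 0))) \<and> R t \<sigma> \<sigma>'"
        unfolding R_def by (metis fst_conv snd_conv prod.collapse nat.distinct(1))
    qed
    then show ?thesis by blast
  qed
  then obtain f where f: "\<And>t. logs (conf E t) (f t)" "f 0 = (\<lambda>_. init_lstate, \<lambda>_. [], \<lambda>_ _. 0)"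
    "\<And>t. R t (f t) (f (Suc t))" by blast
  have "run E (\<lambda>t. fst (f t)) (\<lambda>t. fst (snd (f t))) (\<lambda>t. snd (snd (f t)))"
    by unfold_locales (use assms f in \<open>auto simp: R_def\<close>)
  then show ?thesis using that by blast
qed

lemma finite_eventually:
  fixes P :: "'a \<Rightarrow> nat \<Rightarrow> bool"
  assumes "finite A" "\<And>x. x \<in> A \<Longrightarrow> \<exists>u. P x u" "\<And>x u w. P x u \<Longrightarrow> u \<le> w \<Longrightarrow> P x w"
  shows "\<exists>u. \<forall>x \<in> A. P x u"
  using assms(1,2)
proof (induction A rule: finite_induct)
  case (insert x A)
  then obtain u where "\<forall>x \<in> A. P x u" by auto
  moreover obtain w where "P x w" using insert.prems by auto
  ultimately have "\<forall>y \<in> insert x A. P y (max u w)" using assms(3) by (metis insert_iff max.cobounded1 max.cobounded2)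
  then show ?case by blast
qed simp

context run
begin

abbreviation VC where "VC t i \<equiv> l_ValClock (L t i)"

lemma wf: "wf_log (S t)" and proc_inv: "proc_inv (S t) i (r t i) (L t i)"
proof -
  have "wf_log (S t) \<and> (\<forall>i. proc_inv (S t) i (r t i) (L t i))"
  proof (induction t)
    case 0
    show ?case
      unfolding init wf_log_def proc_inv_def view_inv_def sender_inv_def heard_def
      by (auto simp: init_lstate_def clocked_def)
  next
    case (Suc t)
    then have IH: "wf_log (S t)" "\<And>i. proc_inv (S t) i (r t i) (L t i)" by auto
    from lstep[of t] show ?case
    proof cases
      case (update i v s ms)
      note u = proc_inv_update[OF IH(1) IH(2)[of i] update(6,7)]
      have "proc_inv (S (Suc t)) l (r t l) (L t l)" if "l \<noteq> i" for l
        by (rule proc_inv_mono[OF IH(2)]) (use u(1) that update(2) in auto)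
      moreover have "proc_inv (S (Suc t)) i (r t i) s" "wf_log (S (Suc t))" using u(1,2) update(2) by auto
      ultimately show ?thesis using update(1,3) by (simp del: fun_upd_apply) (simp add: fun_upd_def)
    next
      case (receive i j s ms)
      note h = proc_inv_handler[OF IH(1) IH(2)[of i] receive(6,7)]
      have "proc_inv (S (Suc t)) l (r t l) (L t l)" if "l \<noteq> i" for l
        by (rule proc_inv_mono[OF IH(2)]) (use h(1) that receive(2) in auto)
      moreover have "proc_inv (S (Suc t)) i ((r t i)(j := Suc (r t i j))) s" "wf_log (S (Suc t))"
        using h(1,2) receive(2) by auto
      ultimately show ?thesis using receive(1,3) by (simp del: fun_upd_apply) (simp add: fun_upd_def)
    qed (use IH in auto)
  qed
  then show "wf_log (S t)" "proc_inv (S t) i (r t i) (L t i)" by auto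
qed

lemma view_inv: "view_inv (S t) (r t i) (L t i)" and sender_inv: "sender_inv (S t) i (r t i) (L t i)"
  using proc_inv unfolding proc_inv_def by blast+

lemma step_mono: "prefix (S t l) (S (Suc t) l)" "VC t l k \<le> VC (Suc t) l k" "r t i j \<le> r (Suc t) i j"
proof -
  have "prefix (S t l) (S (Suc t) l) \<and> VC t l k \<le> VC (Suc t) l k \<and> r t i j \<le> r (Suc t) i j"
    using lstep[of t]
  proof cases
    case (update i v s ms)
    then show ?thesis using proc_inv_update(4)[OF wf proc_inv update(6,7)] by auto
  next
    case (receive i' j' s ms)
    then show ?thesis using proc_inv_handler(5)[OF wf proc_inv receive(6,7), of k] by auto
  qed auto
  then show "prefix (S t l) (S (Suc t) l)" "VC t l k \<le> VC (Suc t) l k" "r t i j \<le> r (Suc t) i j"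
    by blast+
qed

lemma prefix_S: "t \<le> u \<Longrightarrow> prefix (S t l) (S u l)"
  by (induction rule: dec_induct) (auto intro: step_mono prefix_order.trans)

lemma keys_mono: "t \<le> u \<Longrightarrow> m \<in> keys (S t l) \<Longrightarrow> m \<in> keys (S u l)"
  using set_mono_prefix[OF prefix_S] by blast

lemma VC_mono: "t \<le> u \<Longrightarrow> VC t l k \<le> VC u l k"
  by (induction rule: dec_induct) (auto intro: step_mono le_trans)

lemma r_mono: "t \<le> u \<Longrightarrow> r t i j \<le> r u i j"
  by (induction rule: dec_induct) (auto intro: step_mono le_trans)

lemma r_le: "r t i j \<le> length (S t j)"
  using view_invD(1)[OF view_inv] .

lemma received_mono:
  assumes "t \<le> u" "m \<in> keys (take (r t i l) (S t l))"
  shows "m \<in> keys (take (r u i l) (S u l))"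
proof -
  have "take (r t i l) (S u l) = take (r t i l) (S t l)"
    using take_prefix_eq[OF prefix_S[OF assms(1)] r_le] .
  moreover have "set (take (r t i l) (S u l)) \<subseteq> set (take (r u i l) (S u l))"
    using set_take_subset_set_take[OF r_mono[OF assms(1)]] .
  ultimately show ?thesis using assms(2) by auto
qed

lemma conf_step: "step (conf E t) (act E t) (conf E (Suc t))"
  using admissible unfolding admissible_def by blast

lemma crashed_mono: "t \<le> u \<Longrightarrow> c_crashed (conf E t) \<subseteq> c_crashed (conf E u)"
proof (induction rule: dec_induct)
  case (step n)
  have "c_crashed (conf E n) \<subseteq> c_crashed (conf E (Suc n))" using conf_step[of n] by cases auto
  then show ?case using step by blast
qed simp

lemma not_crashed: "i \<notin> faulty E \<Longrightarrow> i \<notin> c_crashed (conf E t)"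
  unfolding faulty_def by blast

lemma crashed_frozen:
  assumes "l \<in> c_crashed (conf E t)" "t \<le> u"
  shows "S u l = S t l"
  using assms(2)
proof (induction rule: dec_induct)
  case (step n)
  have "l \<in> c_crashed (conf E n)" using crashed_mono[OF step(1)] assms(1) by blast
  with lstep[of n] have "S (Suc n) l = S n l" by cases auto
  then show ?case using step by simp
qed simp

section \<open>Chain property of the validated stamps\<close>

lemma VC_key: "VC t i k = 0 \<and> l_X (L t i) k = 0 \<or>
    Message (l_X (L t i) k) k (VC t i k) (VC t i k) \<in> set (S t k)"
  using view_invD(6)[OF view_inv] .

lemma majority_correct: "majority (- faulty E)"
proof -
  have "card (- faulty E) = CARD('p) - card (faulty E)" 
    by (simp add: Compl_eq_Diff_UNIV card_Diff_subset)
  then show ?thesis using admissible unfolding admissible_def majority_def by linarith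
qed

lemma ordered:
  assumes "(k, t) \<in> keys (S u k)" "t \<le> VC u i k" "VC u i k' < t'" "u \<le> w"
  shows "majority {l. before (S w l) (k, t) (k', t')}"
  using view_invD(7)[OF view_inv assms(1-3)]
  by (rule majority_mono) (use prefix_S[OF assms(4)] before_mono in blast)

lemma comparable: "(\<forall>k. VC t i k \<le> VC u j k) \<or> (\<forall>k. VC u j k \<le> VC t i k)"
proof (rule ccontr)
  assume "\<not> ?thesis"
  then obtain k k' where less: "VC u j k < VC t i k" "VC t i k' < VC u j k'" by (auto simp: not_le)
  have "(k, VC t i k) \<in> keys (S t k)" "(k', VC u j k') \<in> keys (S u k')"
    using VC_key[of t i k] VC_key[of u j k'] less by (force, force)
  then have "majority {l. before (S (max t u) l) (k, VC t i k) (k', VC u j k')}"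
    "majority {l. before (S (max t u) l) (k', VC u j k') (k, VC t i k)}"
    using ordered[of k "VC t i k" t i k' "VC u j k'" "max t u"]
      ordered[of k' "VC u j k'" u j k "VC t i k" "max t u"] less by simp_all
  then show False using before_asym by (metis majority_meet mem_Collect_eq)
qed

text \<open>The updates bound to reach everybody: what one correct process logs is delivered to, and
  logged by, all correct processes.\<close>

definition stable :: "'p \<times> nat \<Rightarrow> bool" where
  "stable m \<longleftrightarrow> (\<exists>l u. l \<notin> faulty E \<and> m \<in> keys (S u l))"

lemma VC_stable:
  assumes "VC t i k > 0"
  shows "stable (k, VC t i k)"
proof -
  have "(k, VC t i k) \<in> keys (S t k)" using VC_key[of t i k] assms by force
  \<comment> \<open>The stamp \<open>Suc (VC t i k)\<close> need not have been issued. As some stamp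
    not validated it makes \<open>ordered\<close> yield a majority of logs that contain the
    validated one, and a correct process is among them.\<close>
  then have "majority {l. before (S t l) (k, VC t i k) (k, Suc (VC t i k))}"
    using ordered[of k "VC t i k" t i k "Suc (VC t i k)" t] by simp
  then obtain l where "l \<notin> faulty E" "before (S t l) (k, VC t i k) (k, Suc (VC t i k))"
    using majority_correct by (metis ComplD majority_meet mem_Collect_eq)
  then show ?thesis using before_sent unfolding stable_def by blast
qed

section \<open>Liveness\<close>

text \<open>Were position \<open>p\<close> never received, the channel would stay nonempty forever,
  and by fairness the number of received messages would grow beyond \<open>p\<close>.\<close>

lemma eventually_received:
  assumes i: "i \<notin> faulty E" and p: "p < r t i j + length (c_chan (conf E t) j i)"
  shows "\<exists>u \<ge> t. p < r u i j"
proof (rule ccontr)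
  assume "\<not> ?thesis"
  then have le: "r u i j \<le> p" if "u \<ge> t" for u using that by (simp add: not_less)
  have "p < r u i j + length (c_chan (conf E u) j i)" if "u \<ge> t" for u
    using that by (induction rule: dec_induct) (use p pending less_le_trans in blast)+
  then have ne: "c_chan (conf E u) j i \<noteq> []" if "u \<ge> t" for u
    using that le[OF that] by fastforce
  have "\<exists>u \<ge> t. n \<le> r u i j" for n
  proof (induction n)
    case (Suc n)
    then obtain u where u: "u \<ge> t" "n \<le> r u i j" by blast
    obtain w where w: "w \<ge> u" "act E w = Receive i j"
      using ne[OF u(1)] i admissible unfolding admissible_def fair_def by blast
    have "r (Suc w) i j = Suc (r w i j)" using lstep[of w] by cases (use w in auto)
    then show ?case using u w r_mono[OF w(1), of i j] by (intro exI[of _ "Suc w"]) auto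
  qed blast
  then show False using le by (metis not_less_eq_eq)
qed

text \<open>It suffices that \<open>j\<close> is alive at time \<open>t\<close>: its whole log has
  then been put on the channels, and a later crash withdraws nothing.\<close>

lemma deliver:
  assumes i: "i \<notin> faulty E" and j: "j \<notin> c_crashed (conf E t)" and m: "m \<in> keys (S t j)"
  shows "\<exists>u. m \<in> keys (take (r u i j) (S u j))"
proof -
  obtain p where p: "p < length (S t j)" "key (S t j ! p) = m"
    using m by (auto simp: in_set_conv_nth)
  have "c_chan (conf E t) j i = drop (r t i j) (S t j)" using logs[of t] j unfolding logs_def by auto
  then have "p < r t i j + length (c_chan (conf E t) j i)" using p r_le[of t i j] by simp
  then obtain u where u: "u \<ge> t" "p < r u i j" using eventually_received[OF i] by blast
  have "S u j ! p = S t j ! p" using prefix_S[OF u(1), of j] p(1) by (auto simp: prefix_def nth_append)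
  moreover have "take (r u i j) (S u j) ! p \<in> set (take (r u i j) (S u j))"
    using u(2) r_le[of u i j] by (intro nth_mem) simp
  ultimately show ?thesis using p(2) u(2) by (metis image_eqI nth_take)
qed

lemma heard_sent:
  assumes "m \<in> keys (take (r u i j) (S u j))"
  shows "m \<in> keys (S u i)"
  using sender_invD(2)[OF sender_inv] assms unfolding heard_def by blast

lemma stable_sent:
  assumes "stable m" "i \<notin> faulty E"
  shows "\<exists>u. m \<in> keys (S u i)"
  using assms deliver[OF assms(2) not_crashed] heard_sent unfolding stable_def by metis

lemma stable_received:
  assumes "stable m" "i \<notin> faulty E" "l \<notin> faulty E"
  shows "\<exists>u. m \<in> keys (take (r u i l) (S u l))"
  using stable_sent[OF assms(1,3)] deliver[OF assms(2) not_crashed[OF assms(3)]] by blast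

lemma stable_sent_by:
  assumes "finite M" "\<And>m. m \<in> M \<Longrightarrow> stable m"
  shows "\<exists>u. \<forall>m \<in> M. \<forall>l \<in> - faulty E. m \<in> keys (S u l)"
proof -
  have "\<exists>u. \<forall>x \<in> M \<times> - faulty E. fst x \<in> keys (S u (snd x))"
  proof (rule finite_eventually)
    show "finite (M \<times> - faulty E)" using assms(1) by simp
    show "\<exists>u. fst x \<in> keys (S u (snd x))" if "x \<in> M \<times> - faulty E" for x
      using that assms(2) stable_sent by (cases x) simp
  qed (rule keys_mono)
  then show ?thesis by auto
qed

text \<open>The records of the updates of \<open>D\<close> survive the removal loop of the handler that receives the last
  of their messages sent by correct processes.\<close>

lemma closed_set_validated:
  assumes i: "i \<notin> faulty E" and D: "finite D" "\<And>m. m \<in> D \<Longrightarrow> stable m"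
    and closed: "\<And>m m'. m \<in> D \<Longrightarrow> m' \<notin> D \<Longrightarrow>
      majority {l. l \<notin> faulty E \<and> (\<exists>u. before (S u l) m m')}"
  shows "\<exists>u. \<forall>(k, t) \<in> D. t \<le> VC u i k"
proof (cases "D = {}")
  case False
  let ?got = "\<lambda>u. \<forall>m \<in> D. \<forall>l \<in> - faulty E. m \<in> keys (take (r u i l) (S u l))"
  have "\<exists>u. \<forall>x \<in> D \<times> - faulty E. fst x \<in> keys (take (r u i (snd x)) (S u (snd x)))"
  proof (rule finite_eventually)
    show "finite (D \<times> - faulty E)" using D(1) by simp
    show "\<exists>u. fst x \<in> keys (take (r u i (snd x)) (S u (snd x)))" if "x \<in> D \<times> - faulty E" for x
      using that D(2) stable_received i by (cases x) simp
  qed (rule received_mono)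
  then have ex: "\<exists>u. ?got u" by auto
  \<comment> \<open>At time \<open>U\<close> all messages about \<open>D\<close> from correct
    processes have just arrived. The preceding step is therefore a reception by \<open>i\<close>,
    and its handler validates whatever of \<open>D\<close> is still missing.\<close>
  define U where "U = (LEAST u. ?got u)"
  have U: "?got U" unfolding U_def using ex by (rule LeastI_ex)
  \<comment> \<open>With a correct process and a member of \<open>D\<close>, something is missing at
    time 0, so \<open>U\<close> has a predecessor.\<close>
  have "- faulty E \<noteq> {}"
  proof
    assume "- faulty E = {}"
    then show False using majority_correct by simp
  qed
  then obtain l where "l \<in> - faulty E" by blast
  moreover obtain m where "m \<in> D" using False by blast
  moreover have "m \<notin> keys (take (r 0 i l) (S 0 l))" by (simp add: init)
  ultimately have "\<not> ?got 0" by blast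
  then obtain u where u: "U = Suc u" using U by (cases U) auto
  then have nu: "\<not> ?got u" using not_less_Least[of u ?got] unfolding U_def by simp
  from lstep[of u] show ?thesis
  proof cases
    case (update i' v s ms)
    have "take (r u i l) (S (Suc u) l) = take (r u i l) (S u l)" for l
      using take_prefix_eq[OF step_mono(1) r_le] .
    then show ?thesis using U nu update(3) unfolding u by simp
  next
    case idle
    then show ?thesis using U nu unfolding u by simp
  next
    case (receive i' j s ms)
    have tk: "take (r u i l) (S (Suc u) l) = take (r u i l) (S u l)" for l
      using take_prefix_eq[OF step_mono(1) r_le] .
    have "i' = i"
    proof (rule ccontr)
      assume "i' \<noteq> i"
      then show False using U nu receive(3) tk unfolding u by simp
    qed
    let ?r = "(r u i)(j := Suc (r u i j))"
    obtain s1 s2 where s: "view_inv (S u) ?r s1" "validate_code s1 s2" "l_ValClock s = l_ValClock s2"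
      using handler_view[OF wf proc_inv receive(6,7)] \<open>i' = i\<close> by metis
    have r': "?r = r (Suc u) i" using receive(3) \<open>i' = i\<close> by simp
    have tk': "take (?r l) (S u l) = take (r (Suc u) i l) (S (Suc u) l)" for l
      using take_prefix_eq[OF step_mono(1) view_invD(1)[OF s(1)]] unfolding r' by metis
    have got: "m \<in> keys (take (?r l) (S u l))" if "m \<in> D" "l \<notin> faulty E" for m l
      using U that unfolding tk' u by blast
    have "t \<le> l_ValClock s2 k" if kt: "(k, t) \<in> D" for k t
    proof (rule stable_validated[OF wf s(1,2)])
      show "majority {l. m \<in> keys (take (?r l) (S u l))}" if "m \<in> D" for m
        using majority_correct by (rule majority_mono) (use got that in blast)
      show "majority {l. before (take (?r l) (S u l)) m m'}" if m: "m \<in> D" "m' \<notin> D" for m m'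
        using closed[OF m]
      proof (rule majority_mono, safe)
        fix l w assume l: "l \<notin> faulty E" "before (S w l) m m'"
        \<comment> \<open>The precedence may be witnessed only later than \<open>u\<close>, but the
          received prefix contains \<open>m\<close> and so decides the order itself.\<close>
        then have "before (S (max u w) l) m m'" using before_mono prefix_S max.cobounded2 by metis
        moreover have "prefix (take (?r l) (S u l)) (S (max u w) l)"
          using prefix_S[of u "max u w" l] take_is_prefix prefix_order.trans by (metis max.cobounded1)
        ultimately show "before (take (?r l) (S u l)) m m'"
          using before_prefix got[OF m(1) l(1)] by blast
      qed
    qed (fact kt)
    moreover have "VC (Suc u) i = l_ValClock s2" using receive(1) s(3) \<open>i' = i\<close> by simp
    ultimately show ?thesis by (intro exI[of _ "Suc u"]) auto
  qed
qed auto

lemma before_unstable: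
  assumes "stable m" "\<not> stable m'"
  shows "majority {l. l \<notin> faulty E \<and> (\<exists>u. before (S u l) m m')}"
  using majority_correct
proof (rule majority_mono, safe)
  fix l assume l: "l \<notin> faulty E"
  then obtain u where "m \<in> keys (S u l)" using stable_sent assms(1) by blast
  moreover have "m' \<notin> keys (S u l)" using assms(2) l unfolding stable_def by blast
  ultimately show "\<exists>u. before (S u l) m m'" by (blast intro: beforeI_unsent)
qed

text \<open>If \<open>(a, t)\<close> were missing when \<open>k\<close> has validated its own
  \<open>t1\<close>, a majority of logs, hence a correct one, would have \<open>(k, t1)\<close>
  before \<open>(a, t)\<close>. But the correct processes logged \<open>(a, t)\<close> before
  \<open>t1\<close> was launched.\<close>

lemma unbounded_validates:
  assumes k: "infinite {t. stable (k, t)}" and m: "stable (a, t)"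
  shows "\<exists>u. t \<le> VC u k a"
proof -
  obtain T where T: "\<And>l. l \<notin> faulty E \<Longrightarrow> (a, t) \<in> keys (S T l)"
    using stable_sent_by[of "{(a, t)}"] m by auto
  \<comment> \<open>A stamp beyond the length of the log at \<open>T\<close> is launched after
    \<open>T\<close>. The larger stamp \<open>t2\<close> shows that \<open>k\<close> launched again,
    which requires that it has validated \<open>t1\<close>.\<close>
  obtain t1 where t1: "length (S T k) < t1" "stable (k, t1)"
    using k unfolding infinite_nat_iff_unbounded by blast
  obtain t2 where t2: "t1 < t2" "stable (k, t2)"
    using k unfolding infinite_nat_iff_unbounded by blast
  have real: "\<exists>u. (k, t') \<in> keys (S u k)" if "stable (k, t')" for t'
    using that wf_log_own[OF wf] unfolding stable_def by (metis key.simps image_eqI)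
  obtain u1 u2 where "(k, t1) \<in> keys (S u1 k)" "(k, t2) \<in> keys (S u2 k)"
    using real t1(2) t2(2) by blast
  then obtain u where u: "(k, t1) \<in> keys (S u k)" "(k, t2) \<in> keys (S u k)"
    using keys_mono max.cobounded1 max.cobounded2 by metis
  have le: "t1 \<le> VC u k k" using sender_invD(4)[OF sender_inv u t2(1)] .
  show ?thesis
  proof (rule ccontr)
    assume "\<nexists>u. t \<le> VC u k a"
    then have "VC u k a < t" by (simp add: not_le)
    from ordered[OF u(1) le this, of "max T u"]
    obtain l where l: "l \<notin> faulty E" "before (S (max T u) l) (k, t1) (a, t)"
      using majority_correct by (metis ComplD majority_meet mem_Collect_eq max.cobounded2)
    have "(k, t1) \<notin> keys (S T l)" using wf_log_own[OF wf, of k t1 T l] t1(1) by (metis not_le)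
    then have "before (S (max T u) l) (a, t) (k, t1)"
      using T[OF l(1)] prefix_S max.cobounded1 by (blast intro: beforeI_unsent)
    then show False using l(2) before_asym by blast
  qed
qed

lemma eventually_validated:
  assumes m: "stable (a, t)" and i: "i \<notin> faulty E"
  shows "\<exists>u. t \<le> VC u i a"
proof (cases "finite {m. stable m}")
  case True
  have "\<exists>u. \<forall>(k, t) \<in> {m. stable m}. t \<le> VC u i k"
    using closed_set_validated[OF i True] before_unstable by simp
  then show ?thesis using m by auto
next
  case False
  have "{m. stable m} = (\<Union>k. Pair k ` {t. stable (k, t)})" by auto
  then have "infinite (\<Union>k. Pair k ` {t. stable (k, t)})" using False by simp
  then have "\<exists>k. infinite {t. stable (k, t)}" by (auto dest: finite_imageD)
  then obtain k where k: "infinite {t. stable (k, t)}" by blast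
  have fin: "finite {m. stable m \<and> (\<exists>l. m \<in> keys (S u l))}" for u
    by (rule finite_subset[of _ "\<Union>l. keys (S u l)"]) auto
  have "\<exists>T. \<forall>f \<in> faulty E. f \<in> c_crashed (conf E T)"
    by (rule finite_eventually) (auto simp: faulty_def dest: crashed_mono)
  then obtain T0 where T0: "\<And>f. f \<in> faulty E \<Longrightarrow> f \<in> c_crashed (conf E T0)" by blast
  let ?old = "{m. stable m \<and> (\<exists>l. m \<in> keys (S T0 l))}"
  obtain T1 where T1: "\<And>m l. m \<in> ?old \<Longrightarrow> l \<notin> faulty E \<Longrightarrow> m \<in> keys (S T1 l)"
    using stable_sent_by[OF fin[of T0]] by blast
  \<comment> \<open>Once \<open>k\<close> has validated all of these, a stable update outside
    \<open>?D\<close> is in no log at time \<open>T1\<close>.\<close>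
  let ?new = "insert (a, t) {m. stable m \<and> (\<exists>l. m \<in> keys (S T1 l))}"
  have "\<exists>T. \<forall>x \<in> ?new. snd x \<le> VC T k (fst x)"
    by (rule finite_eventually) (use fin m in \<open>auto intro: unbounded_validates[OF k] VC_mono le_trans\<close>)
  then obtain T where T: "\<And>x. x \<in> ?new \<Longrightarrow> snd x \<le> VC T k (fst x)" by blast
  let ?D = "{(b, s). stable (b, s) \<and> s \<le> VC T k b}"
  have "\<exists>u. \<forall>(b, s) \<in> ?D. s \<le> VC u i b"
  proof (rule closed_set_validated[OF i])
    show "finite ?D" by (rule finite_subset[of _ "SIGMA b:UNIV. {..VC T k b}"]) auto
    show "stable m" if "m \<in> ?D" for m using that by auto
    show "majority {l. l \<notin> faulty E \<and> (\<exists>u. before (S u l) m m')}" if D: "m \<in> ?D" "m' \<notin> ?D" for m m'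
    proof (cases "stable m'")
      case False
      then show ?thesis using before_unstable D by blast
    next
      case True
      obtain b s b' s' where ms: "m = (b, s)" "m' = (b', s')" by (cases m, cases m')
      have b: "stable (b, s)" "s \<le> VC T k b" "VC T k b' < s'" using D True ms by auto
      then have new: "m' \<notin> ?new" using T[of m'] ms by auto
      show ?thesis
      proof (cases "m \<in> ?old")
        case old: True
        \<comment> \<open>By \<open>T1\<close> every correct log contains the old update
          \<open>m\<close> and none contains \<open>m'\<close>.\<close>
        show ?thesis using majority_correct
        proof (rule majority_mono, safe)
          fix l assume "l \<notin> faulty E"
          then have "m \<in> keys (S T1 l)" "m' \<notin> keys (S T1 l)" using T1 old new True by auto
          then show "\<exists>u. before (S u l) m m'" by (blast intro: beforeI_unsent)
        qed
      next
        case young: False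
        obtain l0 u where "m \<in> keys (S u l0)" using b(1) ms unfolding stable_def by blast
        then have "(b, s) \<in> keys (S u b)" using wf_log_own[OF wf] ms by (metis key.simps image_eqI)
        \<comment> \<open>Late enough for the owner to have logged \<open>m\<close> and for the logs
          of faulty processes to be frozen. These logs lack the young update \<open>m\<close>, so
          the majority that puts \<open>m\<close> first consists of correct processes.\<close>
        let ?w = "max (max T0 T) u"
        have real: "(b, s) \<in> keys (S ?w b)" using keys_mono[OF _ \<open>(b, s) \<in> keys (S u b)\<close>] by simp
        have "view_inv (S ?w) (r T k) (L T k)"
          by (rule view_inv_mono[OF view_inv wf]) (simp add: prefix_S)
        from view_invD(7)[OF this real b(2,3)] show ?thesis
        proof (rule majority_mono, safe)
          fix l assume l: "before (S ?w l) (b, s) (b', s')"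
          then show "\<exists>u. before (S u l) m m'" using ms by blast
          assume "l \<in> faulty E"
          have "S ?w l = S T0 l" by (rule crashed_frozen[OF T0[OF \<open>l \<in> faulty E\<close>]]) simp
          then have "m \<in> keys (S T0 l)" using before_sent[OF l] ms by simp
          moreover have "stable m" using b(1) ms by simp
          ultimately show False using young by blast
        qed
      qed
    qed
  qed
  moreover have "(a, t) \<in> ?D" using m T[of "(a, t)"] by simp
  ultimately show ?thesis by auto
qed

section \<open>Updates and snapshots of a run\<close>

definition updates :: "'p \<Rightarrow> nat \<Rightarrow> nat \<Rightarrow> bool" where
  "updates i v x \<longleftrightarrow> act E x = Do_Update i v \<or> act E x = Do_Update_Crash i v"

text \<open>An update either stores its own value in \<open>l_V\<close> or launches with
  \<open>l_V\<close> empty, and a handler keeps or clears it. A postponed value thus belongs to the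
  latest update.\<close>

lemma postponed_value:
  "l_V (L t i) = Some v \<Longrightarrow> \<exists>x < t. updates i v x \<and> (\<forall>y w. x < y \<longrightarrow> y < t \<longrightarrow> \<not> updates i w y)"
proof (induction t)
  case 0
  then show ?case by (simp add: init init_lstate_def)
next
  case (Suc t)
  have keep: ?case if "l_V (L t i) = Some v" "\<And>w. \<not> updates i w t"
    using Suc.IH[OF that(1)] that(2) by (metis less_Suc_eq)
  from lstep[of t] show ?case
  proof cases
    case (update i' w s ms)
    show ?thesis
    proof (cases "i' = i")
      case True
      then have "l_V s = Some v" using Suc.prems update(1) by simp
      then have "w = v" using proc_inv_update(3)[OF wf proc_inv update(6,7)] by simp
      then have "updates i v t" using update(4) True unfolding updates_def by simp
      then show ?thesis by (intro exI[of _ t]) auto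
    next
      case False
      then show ?thesis using Suc.prems update(1,4) by (intro keep) (auto simp: updates_def)
    qed
  next
    case (receive i' j s ms)
    have "l_V (L t i) = Some v"
      using Suc.prems receive(1) proc_inv_handler(3)[OF wf proc_inv receive(6,7)] by (cases "i' = i") auto
    then show ?thesis using receive(4) by (intro keep) (auto simp: updates_def)
  next
    case idle
    then show ?thesis using Suc.prems by (intro keep) (auto simp: updates_def)
  qed
qed

text \<open>Here \<open>\<tau>\<close> is the step that launches the message:
  \<open>x = \<tau>\<close> for a direct update, and \<open>x < \<tau>\<close> when a handler sends
  a postponed value.\<close>

lemma launched_value:
  assumes "Message v i c c \<in> set (S t i)"
  shows "\<exists>x \<tau>. x \<le> \<tau> \<and> updates i v x \<and> (\<forall>y w. x < y \<longrightarrow> y \<le> \<tau> \<longrightarrow> \<not> updates i w y) \<and>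
    length (S \<tau> i) < c \<and> c \<le> length (S (Suc \<tau>) i)"
  using assms
proof (induction t)
  case 0
  then show ?case by (simp add: init)
next
  case (Suc t)
  show ?case
  proof (cases "Message v i c c \<in> set (S t i)")
    case new: False
    have "clocked (S (Suc t) i)" using wf unfolding wf_log_def by blast
    note n = clocked_nth[OF this Suc.prems]
    have len: "length (S t i) < c"
      using clocked_prefix_mem[OF \<open>clocked (S (Suc t) i)\<close> step_mono(1) Suc.prems] new
      by (meson not_le)
    from lstep[of t] show ?thesis
    proof cases
      case (update i' w s ms)
      then have "i' = i" using new Suc.prems by (auto split: if_splits)
      then have "Message v i c c \<in> set ms" using new Suc.prems update(2) by auto
      then have "w = v" using proc_inv_update(3)[OF wf proc_inv update(6,7)] by auto
      then have "updates i v t" using update(4) \<open>i' = i\<close> unfolding updates_def by simp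
      then show ?thesis using len n(2) by (intro exI[of _ t]) auto
    next
      case (receive i' j s ms)
      then have "i' = i" using new Suc.prems by (auto split: if_splits)
      then have "Message v i c c \<in> set ms" using new Suc.prems receive(2) by auto
      then have "l_V (L t i) = Some v" using proc_inv_handler(4)[OF wf proc_inv receive(6,7)] \<open>i' = i\<close> by blast
      then obtain x where x: "x < t" "updates i v x" "\<forall>y w. x < y \<longrightarrow> y < t \<longrightarrow> \<not> updates i w y"
        using postponed_value by blast
      moreover have "\<not> updates i w t" for w using receive(4) unfolding updates_def by auto
      ultimately have "\<forall>y w. x < y \<longrightarrow> y \<le> t \<longrightarrow> \<not> updates i w y" by (metis order_le_less)
      then show ?thesis using x(1,2) len n(2) by (intro exI[of _ x] exI[of _ t]) auto
    next
      case idle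
      then show ?thesis using new Suc.prems by simp
    qed
  qed (rule Suc.IH)
qed

lemma len_mono: "t \<le> u \<Longrightarrow> length (S t i) \<le> length (S u i)"
  using prefix_S prefix_length_le by blast

text \<open>The launched stamp need not carry the value of \<open>x\<close>, because a later update
  may have replaced it meanwhile.\<close>

lemma update_progress:
  assumes "updates i v x" "x < t"
  shows "l_V (L t i) \<noteq> None \<or> (\<exists>c > length (S x i). (i, c) \<in> keys (S t i))"
proof -
  have "Suc x \<le> t" using assms(2) by simp
  then show ?thesis
  proof (induction rule: dec_induct)
    case base
    from lstep[of x] show ?case
    proof cases
      case (update i' w s ms)
      then have "i' = i" using assms(1) unfolding updates_def by auto
      then show ?thesis using update proc_inv_update(3)[OF wf proc_inv update(6,7)] by auto
    qed (use assms(1) in \<open>auto simp: updates_def\<close>)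
  next
    case (step t)
    have len: "length (S x i) \<le> length (S t i)" using len_mono step(1) by simp
    show ?case
    proof (cases "\<exists>c > length (S x i). (i, c) \<in> keys (S t i)")
      case True
      then show ?thesis using keys_mono[of t "Suc t"] by (meson le_SucI order_refl)
    next
      case False
      then have V: "l_V (L t i) \<noteq> None" using step.IH by blast
      from lstep[of t] show ?thesis
      proof cases
        case (update i' w s ms)
        show ?thesis
        proof (cases "i' = i")
          case True
          from proc_inv_update(3)[OF wf proc_inv update(6,7)] show ?thesis
          proof
            assume "l_V s = None \<and> ms = [Message w i' (Suc (length (S t i'))) (Suc (length (S t i')))]"
            then have "(i, Suc (length (S t i))) \<in> keys (S (Suc t) i)" using update(2) True by simp
            then show ?thesis using len le_imp_less_Suc by blast
          qed (use update(1) True in simp)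
        qed (use V update(1) in simp)
      next
        case (receive i' j s ms)
        show ?thesis
        proof (cases "i' = i")
          case True
          from proc_inv_handler(3)[OF wf proc_inv receive(6,7)] show ?thesis
          proof
            assume "l_V s = None \<and> (\<exists>v. l_V (L t i') = Some v \<and> (\<exists>ms1. ms = ms1 @
              [Message v i' (length (S t i' @ ms)) (length (S t i' @ ms))]))"
            then obtain v ms1 where m: "ms = ms1 @ [Message v i' (length (S t i' @ ms)) (length (S t i' @ ms))]"
              by blast
            then have "Message v i' (length (S t i' @ ms)) (length (S t i' @ ms)) \<in> set ms"
              by (metis in_set_conv_decomp)
            then have "(i, length (S t i @ ms)) \<in> keys (S (Suc t) i)" using receive(2) True by force
            moreover have "ms \<noteq> []" using m by (metis snoc_eq_iff_butlast)
            then have "length (S x i) < length (S t i @ ms)" using len by (simp add: le_less_trans)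
            ultimately show ?thesis by blast
          qed (use receive(1) True V in simp)
        qed (use V receive(1) in simp)
      next
        case idle
        then show ?thesis using V by simp
      qed
    qed
  qed
qed

lemma return_snapshotD:
  assumes "act E u = Return_Snapshot i a"
  shows "a = l_X (L u i)" "l_V (L u i) = None" "(i, c) \<in> keys (S u i) \<Longrightarrow> c \<le> VC u i i"
proof -
  have ret: "can_return (conf E u) i" "a = l_X (c_local (conf E u) i)"
    using conf_step[of u] assms by (auto elim: step.cases)
  then have nc: "i \<notin> c_crashed (conf E u)" unfolding can_return_def free_def by simp
  then have L: "L u i = c_local (conf E u) i" using logs[of u] unfolding logs_def by auto
  show "a = l_X (L u i)" "l_V (L u i) = None" using ret L unfolding can_return_def by auto
  have no: "no_own i (L u i)" using ret L unfolding can_return_def by auto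
  \<comment> \<open>A process may return only with an empty channel to itself, so no own message
    still lacks its record.\<close>
  have "drop (r u i i) (S u i) = []"
    using logs[of u] nc ret(1) unfolding logs_def can_return_def free_def by auto
  then show "c \<le> VC u i i" if "(i, c) \<in> keys (S u i)"
    using own_heard[OF view_inv no that] by simp
qed

text \<open>\<open>crash_interrupted\<close> reads local states even after a crash, while the logged
  state is tied to the actual one only before. A crash leaves the actual local state as it was at
  the last moment alive.\<close>

lemma local_of_crashed:
  assumes "i \<notin> c_crashed (conf E t)" "t \<le> u"
  shows "\<exists>w. t \<le> w \<and> w \<le> u \<and> i \<notin> c_crashed (conf E w) \<and> c_local (conf E u) i = c_local (conf E w) i"
  using assms(2)
proof (induction rule: dec_induct)
  case base
  then show ?case using assms(1) by blast
next
  case (step u)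
  show ?case
  proof (cases "i \<in> c_crashed (conf E (Suc u))")
    case True
    have "c_local (conf E (Suc u)) i = c_local (conf E u) i"
      using conf_step[of u] True by cases (auto simp: free_def can_receive_def)
    then show ?thesis using step by (metis le_SucI)
  next
    case False
    then show ?thesis using step by (metis le_SucI order_refl)
  qed
qed

text \<open>Otherwise the value stays postponed, so an own record is always present. The record
  \<open>g\<close> present right after \<open>x\<close> is eventually validated; an own record
  \<open>g'\<close> found then has a larger stamp, yet was logged before \<open>x\<close> as nothing
  was launched since. But to launch \<open>g'\<close> the process must have validated
  \<open>g\<close>.\<close>

lemma update_eventually_launched:
  assumes "updates i v x" "i \<notin> faulty E"
  shows "\<exists>u > x. \<exists>c > length (S x i). (i, c) \<in> keys (S u i)"
proof (rule ccontr)
  assume neg: "\<not> ?thesis"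
  then have "l_V (L u i) \<noteq> None" if "x < u" for u using update_progress[OF assms(1) that] that by blast
  then have own: "\<exists>g \<in> l_G (L u i). e_k g = i" if "x < u" for u
    using proc_inv[of u i] that unfolding proc_inv_def no_own_def by blast
  have ownkey: "VC u i i < e_t g \<and> (i, e_t g) \<in> keys (S u i)" if "g \<in> l_G (L u i)" "e_k g = i" for g u
    using view_invD(2,3)[OF view_inv that(1)] that(2) unfolding record_ok_def by force
  obtain g where g: "g \<in> l_G (L (Suc x) i)" "e_k g = i" using own by blast
  then have "stable (i, e_t g)" using ownkey assms(2) unfolding stable_def by blast
  then obtain u where u: "e_t g \<le> VC u i i" using eventually_validated assms(2) by blast
  define w where "w = max u (Suc x)"
  have "x < w" unfolding w_def by simp
  then obtain g' where g': "g' \<in> l_G (L w i)" "e_k g' = i" using own by blast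
  note k' = ownkey[OF g'] and k = ownkey[OF g]
  have less: "e_t g < e_t g'" using u VC_mono[of u w i i] k' unfolding w_def by simp
  obtain v' where v': "Message v' i (e_t g') (e_t g') \<in> set (S w i)"
    using wf_log_own[OF wf] k' by metis
  have le: "e_t g' \<le> length (S x i)" using neg k' \<open>x < w\<close> by (meson not_le)
  have cl: "clocked (S w i)" using wf unfolding wf_log_def by blast
  have "prefix (S x i) (S w i)" using prefix_S \<open>x < w\<close> by simp
  then have "Message v' i (e_t g') (e_t g') \<in> set (S x i)"
    by (rule clocked_prefix_mem[OF cl _ v' le])
  then have "(i, e_t g') \<in> keys (S x i)" by force
  then have "(i, e_t g') \<in> keys (S (Suc x) i)" using keys_mono[of x "Suc x"] by simp
  then have "e_t g \<le> VC (Suc x) i i" using sender_invD(4)[OF sender_inv _ _ less] k by blast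
  then show False using k by simp
qed

text \<open>A process launches the value of an update, or of a later one that overwrote it, under the first
  of its own stamps that exceeds the length of its log at the time of the update.\<close>

definition observable :: "'p \<Rightarrow> nat \<Rightarrow> bool" where
  "observable i x \<longleftrightarrow> (\<exists>c > length (S x i). stable (i, c))"

text \<open>An own message logged by a process still alive reaches a correct process, so a launch
  before the crash is enough. For a faulty process, not being interrupted means that
  \<open>l_V\<close> was cleared while it was alive.\<close>

lemma completed_update_observable:
  assumes x: "act E x = Do_Update i v" and nci: "x \<notin> crash_interrupted E"
  shows "observable i x"
proof -
  have upd: "updates i v x" using x unfolding updates_def by simp
  have "\<exists>u c. i \<notin> c_crashed (conf E u) \<and> length (S x i) < c \<and> (i, c) \<in> keys (S u i)"
  proof (cases "i \<in> faulty E")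
    case True
    then obtain u where u: "x < u" "l_V (c_local (conf E u) i) = None"
      using x nci unfolding crash_interrupted_def by blast
    have "i \<notin> c_crashed (conf E (Suc x))"
      using conf_step[of x] x by (auto elim!: step.cases simp: free_def)
    then obtain w where w: "Suc x \<le> w" "i \<notin> c_crashed (conf E w)" "l_V (c_local (conf E w) i) = None"
      using local_of_crashed[of i "Suc x" u] u by auto
    then have "l_V (L w i) = None" using logs[of w] unfolding logs_def by auto
    then show ?thesis using update_progress[OF upd, of w] w by auto
  next
    case False
    then show ?thesis using update_eventually_launched[OF upd] not_crashed by blast
  qed
  then obtain u c where u: "i \<notin> c_crashed (conf E u)" "length (S x i) < c" "(i, c) \<in> keys (S u i)"
    by blast
  obtain l where l: "l \<notin> faulty E"
    using majority_correct by (metis ComplD majority_meet)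
  obtain w where "(i, c) \<in> keys (take (r w l i) (S w i))" using deliver[OF l u(1,3)] by blast
  then have "stable (i, c)" using heard_sent l unfolding stable_def by blast
  then show ?thesis using u(2) unfolding observable_def by blast
qed

lemma waiting_snapshot:
  assumes "act E s = Call_Snapshot i" "s < t"
    "\<And>w b. s < w \<Longrightarrow> w < t \<Longrightarrow> act E w \<noteq> Return_Snapshot i b"
  shows "i \<in> c_waiting (conf E t)"
proof -
  have "Suc s \<le> t" using assms(2) by simp
  then show ?thesis using assms(3)
  proof (induction rule: dec_induct)
    case base
    show ?case using conf_step[of s] assms(1) by (auto elim: step.cases)
  next
    case (step t)
    then have "i \<in> c_waiting (conf E t)" "\<And>b. act E t \<noteq> Return_Snapshot i b" by auto
    with conf_step[of t] show ?case by cases auto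
  qed
qed

section \<open>The order of the operations\<close>

definition returns :: "nat \<Rightarrow> nat" where
  "returns s = (LEAST u. s < u \<and> (\<exists>i a. act E s = Call_Snapshot i \<and> act E u = Return_Snapshot i a))"

lemma snapshot_resultD:
  assumes "snapshot_result E s i a"
  shows "act E s = Call_Snapshot i" "s < returns s" "act E (returns s) = Return_Snapshot i a"
    "\<And>w b. s < w \<Longrightarrow> w < returns s \<Longrightarrow> act E w \<noteq> Return_Snapshot i b"
    "a = l_X (L (returns s) i)"
proof -
  obtain u where u: "act E s = Call_Snapshot i" "s < u" "act E u = Return_Snapshot i a"
    "\<And>w b. s < w \<Longrightarrow> w < u \<Longrightarrow> act E w \<noteq> Return_Snapshot i b"
    using assms unfolding snapshot_result_def by blast
  have "returns s = u" unfolding returns_def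
    by (rule Least_equality) (use u in \<open>auto simp: not_less[symmetric]\<close>)
  then show "act E s = Call_Snapshot i" "s < returns s" "act E (returns s) = Return_Snapshot i a"
    "\<And>w b. s < w \<Longrightarrow> w < returns s \<Longrightarrow> act E w \<noteq> Return_Snapshot i b"
    using u by auto
  then show "a = l_X (L (returns s) i)" using return_snapshotD by blast
qed

fun operation :: "nat \<Rightarrow> 'p action \<Rightarrow> 'p tagged" where
  "operation t (Do_Update i v) = (i, Update v)"
| "operation t (Do_Update_Crash i v) = (i, Update v)"
| "operation t (Call_Snapshot i) = (i, Snapshot (l_X (L (returns t) i)))"
| "operation t a = undefined"

abbreviation oper :: "nat \<Rightarrow> 'p tagged" where "oper t \<equiv> operation t (act E t)"

abbreviation proc :: "nat \<Rightarrow> 'p" where "proc t \<equiv> fst (oper t)"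

definition snaps :: "nat set" where
  "snaps = {s. \<exists>i a. snapshot_result E s i a}"

text \<open>No snapshot sees an unobservable update, so such an update comes after all snapshots and
  is dropped lest its past be infinite. With finitely many invocations this danger is absent, and
  every returned update is kept.\<close>

definition upds :: "nat set" where
  "upds = {x. \<exists>i v. updates i v x \<and> (observable i x \<or> finite (invoked E) \<and> act E x = Do_Update i v)}"

definition seen :: "nat \<Rightarrow> 'p \<Rightarrow> nat" where
  "seen s = VC (returns s) (proc s)"

definition weight :: "nat \<Rightarrow> nat" where
  "weight s = (\<Sum>k\<in>UNIV. seen s k)"

text \<open>Stamps launched in step \<open>x\<close> or later are exactly those beyond the length of
  the log before that step. So the snapshot shows \<open>x\<close> or a later update of the same
  process.\<close>

definition sees :: "nat \<Rightarrow> nat \<Rightarrow> bool" where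
  "sees s x \<longleftrightarrow> length (S x (proc x)) < seen s (proc x)"

text \<open>The infimum over no snapshot is \<open>\<infinity>\<close>, so updates that nobody sees
  come last.\<close>

definition level :: "nat \<Rightarrow> enat" where
  "level e = (if e \<in> snaps then enat (weight e) else INF s\<in>{s \<in> snaps. sees s e}. enat (weight s))"

definition sort_key :: "nat \<Rightarrow> enat \<times> nat \<times> nat" where
  "sort_key e = (level e, if e \<in> snaps then 1 else 0, e)"

lemma proc_update: "updates i v x \<Longrightarrow> proc x = i \<and> oper x = (i, Update v)"
  unfolding updates_def by auto

lemma snapsD:
  assumes "s \<in> snaps"
  shows "act E s = Call_Snapshot (proc s)" "s < returns s"
    "oper s = (proc s, Snapshot (l_X (L (returns s) (proc s))))"
    "act E (returns s) = Return_Snapshot (proc s) (l_X (L (returns s) (proc s)))"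
    "\<And>w b. s < w \<Longrightarrow> w < returns s \<Longrightarrow> act E w \<noteq> Return_Snapshot (proc s) b"
    "snapshot_result E s (proc s) (l_X (L (returns s) (proc s)))"
proof -
  obtain i a where s: "snapshot_result E s i a" using assms unfolding snaps_def by blast
  note d = snapshot_resultD[OF s]
  have "proc s = i" using d(1) by simp
  then show "act E s = Call_Snapshot (proc s)" "s < returns s"
    "oper s = (proc s, Snapshot (l_X (L (returns s) (proc s))))"
    "act E (returns s) = Return_Snapshot (proc s) (l_X (L (returns s) (proc s)))"
    "\<And>w b. s < w \<Longrightarrow> w < returns s \<Longrightarrow> act E w \<noteq> Return_Snapshot (proc s) b"
    "snapshot_result E s (proc s) (l_X (L (returns s) (proc s)))"
    using d s by auto
qed

lemma updsD:
  assumes "x \<in> upds"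
  obtains v where "updates (proc x) v x"
    "observable (proc x) x \<or> finite (invoked E) \<and> act E x = Do_Update (proc x) v"
  using assms proc_update unfolding upds_def by blast

lemma disjoint: "x \<in> upds \<Longrightarrow> x \<notin> snaps"
  using snapsD(1) by (metis updsD updates_def action.distinct(3,15))

lemma seen_mono_iff:
  assumes "s \<in> snaps" "s' \<in> snaps"
  shows "weight s \<le> weight s' \<longleftrightarrow> (\<forall>k. seen s k \<le> seen s' k)"
proof
  assume le: "weight s \<le> weight s'"
  show "\<forall>k. seen s k \<le> seen s' k"
  proof (rule ccontr)
    assume "\<not> ?thesis"
    then obtain k where k: "seen s' k < seen s k" by (auto simp: not_le)
    then have "\<forall>k. seen s' k \<le> seen s k"
      using comparable[of "returns s" "proc s" "returns s'" "proc s'"] unfolding seen_def by (metis not_le)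
    then have "weight s' < weight s" unfolding weight_def using k by (intro sum_strict_mono_ex1) auto
    then show False using le by simp
  qed
qed (simp add: weight_def sum_mono)

text \<open>If some snapshot of no larger weight sees \<open>x\<close>, its vector lies below that
  of \<open>s\<close> by the chain property, so \<open>s\<close> sees \<open>x\<close> too.\<close>

lemma level_le_iff:
  assumes "s \<in> snaps" "x \<in> upds"
  shows "level x \<le> level s \<longleftrightarrow> sees s x"
proof
  assume "level x \<le> level s"
  \<comment> \<open>A strict bound on the infimum yields an actual snapshot below it.\<close>
  then have "level x < enat (Suc (weight s))"
    using assms(1) unfolding level_def by (auto intro: le_less_trans)
  then obtain s' where s': "s' \<in> snaps" "sees s' x" "weight s' < Suc (weight s)"
    using disjoint[OF assms(2)] unfolding level_def by (auto simp: INF_less_iff)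
  then have "\<forall>k. seen s' k \<le> seen s k" using seen_mono_iff[OF s'(1) assms(1)] by simp
  then show "sees s x" using s'(2) unfolding sees_def by (meson less_le_trans)
next
  assume "sees s x"
  then show "level x \<le> level s"
    using assms disjoint[OF assms(2)] unfolding level_def by (auto intro: INF_lower)
qed

lemma sort_key_less_iff:
  assumes "s \<in> snaps" "x \<in> upds"
  shows "sort_key x < sort_key s \<longleftrightarrow> sees s x"
  using level_le_iff[OF assms] assms(1) disjoint[OF assms(2)]
  unfolding sort_key_def by (auto simp: less_prod_def)

text \<open>The wait of a snapshot pays off: on return nothing is postponed, so a stamp beyond the
  threshold of \<open>x\<close> has been launched, and all own stamps are validated.\<close>

lemma sees_own_update:
  assumes "s \<in> snaps" "updates (proc s) v x" "x < s"
  shows "sees s x"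
proof -
  note d = snapsD[OF assms(1)]
  note ret = return_snapshotD[OF d(4)]
  have "x < returns s" using assms(3) d(2) by simp
  then obtain c where "length (S x (proc s)) < c" "(proc s, c) \<in> keys (S (returns s) (proc s))"
    using update_progress[OF assms(2)] ret(2) by blast
  then show ?thesis using ret(3) proc_update[OF assms(2)] unfolding sees_def seen_def by fastforce
qed

text \<open>A waiting process starts no update, so \<open>x\<close> follows the return, and the
  stamps validated at the return lie within the log of that time.\<close>

lemma not_sees_later_update:
  assumes s: "s \<in> snaps" and x: "updates (proc s) v x" "s < x"
  shows "\<not> sees s x"
proof -
  note d = snapsD[OF s]
  have "\<not> x < returns s"
  proof
    assume "x < returns s"
    then have "proc s \<in> c_waiting (conf E x)"
      using waiting_snapshot[OF d(1) x(2)] d(5) by (meson less_trans)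
    then show False using conf_step[of x] x(1) unfolding updates_def by (auto elim: step.cases)
  qed
  then have "length (S (returns s) (proc s)) \<le> length (S x (proc s))" using len_mono by simp
  moreover have "clocked (S (returns s) (proc s))" using wf unfolding wf_log_def by blast
  then have "seen s (proc s) \<le> length (S (returns s) (proc s))"
    using VC_key[of "returns s" "proc s" "proc s"] clocked_nth(2) unfolding seen_def by fastforce
  ultimately show ?thesis using proc_update[OF x(1)] unfolding sees_def by simp
qed

lemma sort_key_update_mono:
  assumes "x \<in> upds" "y \<in> upds" "proc x = proc y" "x \<le> y"
  shows "sort_key x \<le> sort_key y"
proof -
  have "sees s y \<Longrightarrow> sees s x" for s
    using len_mono[OF assms(4)] assms(3) unfolding sees_def by (metis le_less_trans)
  then have "level x \<le> level y"
    using disjoint assms(1,2) unfolding level_def by (auto intro!: INF_superset_mono)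
  then show ?thesis using disjoint assms unfolding sort_key_def by (auto simp: less_eq_prod_def)
qed

lemma sort_key_process_order:
  assumes e: "e \<in> snaps \<union> upds" and e': "e' \<in> snaps \<union> upds" and le: "proc e = proc e'" "e \<le> e'"
  shows "sort_key e \<le> sort_key e'"
proof -
  consider (ss) "e \<in> snaps" "e' \<in> snaps" | (us) "e \<in> upds" "e' \<in> snaps"
    | (su) "e \<in> snaps" "e' \<in> upds" | (uu) "e \<in> upds" "e' \<in> upds" using e e' by blast
  then show ?thesis
  proof cases
    case ss
    note d = snapsD[OF ss(1)] and d' = snapsD[OF ss(2)]
    have "returns e \<le> returns e'"
    proof (rule ccontr)
      assume "\<not> ?thesis"
      then show False using d(5)[of "returns e'"] d'(2,4) le by (metis le_less_trans not_le)
    qed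
    then have "seen e k \<le> seen e' k" for k using VC_mono le(1) unfolding seen_def by metis
    then have "level e \<le> level e'" using seen_mono_iff ss unfolding level_def by simp
    then show ?thesis using ss le(2) unfolding sort_key_def by (auto simp: less_eq_prod_def)
  next
    case us
    obtain v where v: "updates (proc e') v e" using updsD[OF us(1)] le(1) by metis
    have "e \<noteq> e'" using disjoint us by blast
    then have "sees e' e" using sees_own_update[OF us(2) v] le(2) by simp
    then show ?thesis using sort_key_less_iff[OF us(2,1)] by simp
  next
    case su
    obtain v where v: "updates (proc e) v e'" using updsD[OF su(2)] le(1) by metis
    have "e \<noteq> e'" using disjoint su by blast
    then have "\<not> sees e e'" using not_sees_later_update[OF su(1) v] le(2) by simp
    then show ?thesis using sort_key_less_iff[OF su] by simp
  next
    case uu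
    then show ?thesis using sort_key_update_mono le by blast
  qed
qed

text \<open>The shown value was launched in step \<open>\<tau>\<close> and stems from the latest
  update \<open>x\<close> up to \<open>\<tau>\<close>. An update invoked after \<open>\<tau>\<close>
  has a threshold no smaller than the shown stamp; hence a seen update of \<open>j\<close> is not
  later than \<open>\<tau>\<close>, and so not later than \<open>x\<close>.\<close>

lemma snapshot_values:
  assumes s: "s \<in> snaps"
  shows "(l_X (L (returns s) (proc s)) j = 0 \<and>
       (\<forall>x \<in> upds. proc x = j \<longrightarrow> \<not> sort_key x < sort_key s)) \<or>
    (\<exists>x \<in> upds. oper x = (j, Update (l_X (L (returns s) (proc s)) j)) \<and> sort_key x < sort_key s \<and>
       (\<forall>y \<in> upds. proc y = j \<longrightarrow> sort_key y < sort_key s \<longrightarrow> sort_key y \<le> sort_key x))"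
  using VC_key[of "returns s" "proc s" j]
proof
  assume "VC (returns s) (proc s) j = 0 \<and> l_X (L (returns s) (proc s)) j = 0"
  moreover then have "\<not> sort_key x < sort_key s" if "x \<in> upds" "proc x = j" for x
    using sort_key_less_iff[OF s that(1)] that(2) unfolding sees_def seen_def by simp
  ultimately show ?thesis by blast
next
  let ?v = "l_X (L (returns s) (proc s)) j" and ?c = "VC (returns s) (proc s) j"
  assume m: "Message ?v j ?c ?c \<in> set (S (returns s) j)"
  have "clocked (S (returns s) j)" using wf unfolding wf_log_def by blast
  from clocked_nth(1)[OF this m] have "0 < ?c" .
  then have st: "stable (j, ?c)" using VC_stable by blast
  obtain x \<tau> where x: "x \<le> \<tau>" "updates j ?v x" "\<And>y w. x < y \<Longrightarrow> y \<le> \<tau> \<Longrightarrow> \<not> updates j w y"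
    "length (S \<tau> j) < ?c" "?c \<le> length (S (Suc \<tau>) j)"
    using launched_value[OF m] by blast
  have px: "proc x = j" "oper x = (j, Update ?v)" using proc_update[OF x(2)] by auto
  have len: "length (S x j) < ?c" using len_mono[OF x(1), of j] x(4) by simp
  then have "observable j x" using st unfolding observable_def by blast
  then have xu: "x \<in> upds" using x(2) unfolding upds_def by blast
  have "sees s x" using len px(1) unfolding sees_def seen_def by simp
  then have "sort_key x < sort_key s" using sort_key_less_iff[OF s xu] by simp
  moreover have "sort_key y \<le> sort_key x" if y: "y \<in> upds" "proc y = j" "sort_key y < sort_key s" for y
  proof -
    have "length (S y j) < ?c"
      using sort_key_less_iff[OF s y(1)] y(2,3) unfolding sees_def seen_def by simp
    then have "y \<le> \<tau>" using x(5) len_mono[of "Suc \<tau>" y j] by (cases "y \<le> \<tau>") auto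
    moreover obtain w where "updates j w y" using updsD[OF y(1)] y(2) by metis
    ultimately have "y \<le> x" using x(3) not_le by blast
    then show ?thesis using sort_key_update_mono[OF y(1) xu] y(2) px(1) by simp
  qed
  ultimately show ?thesis using xu px(2) by blast
qed

section \<open>Finite pasts\<close>

lemma finite_seen:
  assumes "s \<in> snaps"
  shows "finite {x \<in> upds. sees s x}"
proof (rule finite_subset)
  show "{x \<in> upds. sees s x} \<subseteq> {..<returns s}"
  proof safe
    fix x assume x: "sees s x"
    show "x < returns s"
    proof (rule ccontr)
      assume "\<not> ?thesis"
      then have "length (S (returns s) (proc x)) \<le> length (S x (proc x))" using len_mono by simp
      moreover have "clocked (S (returns s) (proc x))" using wf unfolding wf_log_def by blast
      then have "seen s (proc x) \<le> length (S (returns s) (proc x))"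
        using VC_key[of "returns s" "proc s" "proc x"] clocked_nth(2) unfolding seen_def by fastforce
      ultimately show False using x unfolding sees_def by simp
    qed
  qed
qed simp

text \<open>From some time on, correct processes have validated the stamp and faulty ones invoke
  nothing.\<close>

lemma finite_not_seen:
  assumes "stable (k, t)"
  shows "finite {s \<in> snaps. seen s k < t}"
proof -
  have "\<exists>u. \<forall>i \<in> UNIV. \<forall>s \<in> snaps. proc s = i \<longrightarrow> u \<le> s \<longrightarrow> t \<le> seen s k"
  proof (rule finite_eventually)
    show "\<exists>u. \<forall>s \<in> snaps. proc s = i \<longrightarrow> u \<le> s \<longrightarrow> t \<le> seen s k" for i
    proof (cases "i \<in> faulty E")
      case True
      then obtain u where u: "i \<in> c_crashed (conf E u)" unfolding faulty_def by blast
      have "\<not> u \<le> s" if s: "s \<in> snaps" "proc s = i" for s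
      proof
        assume "u \<le> s"
        then have "i \<in> c_crashed (conf E s)" using u crashed_mono by blast
        then show False using conf_step[of s] snapsD(1)[OF s(1)] s(2)
          by (auto elim!: step.cases simp: free_def)
      qed
      then show ?thesis by blast
    next
      case False
      then obtain u where u: "t \<le> VC u i k" using eventually_validated assms by blast
      have "t \<le> seen s k" if s: "s \<in> snaps" "proc s = i" "u \<le> s" for s
      proof -
        have "u \<le> returns s" using snapsD(2)[OF s(1)] s(3) by simp
        from VC_mono[OF this, of i k] show ?thesis using u s(2) unfolding seen_def by simp
      qed
      then show ?thesis by blast
    qed
  qed (simp, meson le_trans)
  then obtain u where u: "\<And>s. s \<in> snaps \<Longrightarrow> u \<le> s \<Longrightarrow> t \<le> seen s k" by blast
  show ?thesis
  proof (rule finite_subset)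
    show "{s \<in> snaps. seen s k < t} \<subseteq> {..<u}" using u by (auto simp: not_le[symmetric])
  qed simp
qed

text \<open>A snapshot of smaller weight misses one of the finitely many nonzero entries of
  \<open>seen s\<close>. These are stable, so each is missed by finitely many snapshots
  only.\<close>

lemma finite_past_snapshot:
  assumes s: "s \<in> snaps"
  shows "finite {e \<in> snaps \<union> upds. sort_key e \<le> sort_key s}"
proof (rule finite_subset)
  let ?low = "\<Union>k \<in> {k. 0 < seen s k}. {s' \<in> snaps. seen s' k < seen s k}"
  show "{e \<in> snaps \<union> upds. sort_key e \<le> sort_key s} \<subseteq> {x \<in> upds. sees s x} \<union> ?low \<union> {..s}"
  proof
    fix e assume e: "e \<in> {e \<in> snaps \<union> upds. sort_key e \<le> sort_key s}"
    show "e \<in> {x \<in> upds. sees s x} \<union> ?low \<union> {..s}"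
    proof (cases "e \<in> upds")
      case True
      then have "e \<noteq> s" using disjoint s by blast
      then have "sort_key e \<noteq> sort_key s" unfolding sort_key_def by simp
      then have "sort_key e < sort_key s" using e by (simp add: order_le_less)
      then show ?thesis using sort_key_less_iff[OF s True] True by blast
    next
      case False
      then have es: "e \<in> snaps" using e by blast
      have "weight e < weight s \<or> e \<le> s"
        using e es s unfolding sort_key_def level_def by (auto simp: less_eq_prod_def)
      then show ?thesis
      proof
        assume "weight e < weight s"
        then obtain k where k: "seen e k < seen s k" using seen_mono_iff[OF s es] by (auto simp: not_le)
        then have "0 < seen s k" by simp
        then show ?thesis using k es by blast
      qed simp
    qed
  qed
  have "finite ?low"
  proof (rule finite_UN_I)
    show "finite {s' \<in> snaps. seen s' k < seen s k}" if "k \<in> {k. 0 < seen s k}" for k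
      by (rule finite_not_seen) (use that VC_stable in \<open>auto simp: seen_def\<close>)
  qed simp
  then show "finite ({x \<in> upds. sees s x} \<union> ?low \<union> {..s})" using finite_seen[OF s] by simp
qed

text \<open>Observability bounds the number of snapshots blind to \<open>x\<close>. An update of
  lower level is seen by one of them, and each sees finitely many.\<close>

lemma finite_past_update:
  assumes x: "x \<in> upds" and obs: "observable (proc x) x"
  shows "finite {e \<in> snaps \<union> upds. sort_key e \<le> sort_key x}"
proof (rule finite_subset)
  obtain c where c: "length (S x (proc x)) < c" "stable (proc x, c)"
    using obs unfolding observable_def by blast
  let ?blind = "{s \<in> snaps. \<not> sees s x}"
  show "{e \<in> snaps \<union> upds. sort_key e \<le> sort_key x} \<subseteq>
    ?blind \<union> (\<Union>s \<in> ?blind. {y \<in> upds. sees s y}) \<union> {..x}"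
  proof
    fix e assume e: "e \<in> {e \<in> snaps \<union> upds. sort_key e \<le> sort_key x}"
    show "e \<in> ?blind \<union> (\<Union>s \<in> ?blind. {y \<in> upds. sees s y}) \<union> {..x}"
    proof (cases "e \<in> snaps")
      case True
      then show ?thesis using e sort_key_less_iff[OF True x] by (auto simp: not_less[symmetric])
    next
      case False
      then have ey: "e \<in> upds" using e by blast
      have "level e < level x \<or> e \<le> x"
        using e disjoint[OF ey] disjoint[OF x] unfolding sort_key_def by (auto simp: less_eq_prod_def)
      then show ?thesis
      proof
        assume "level e < level x"
        then obtain s where s: "s \<in> snaps" "sees s e" "enat (weight s) < level x"
          using disjoint[OF ey] unfolding level_def[of e] by (auto simp: INF_less_iff)
        then have "\<not> level x \<le> level s" unfolding level_def[of s] by (simp add: not_le)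
        then have "\<not> sees s x" using level_le_iff[OF s(1) x] by simp
        then show ?thesis using s ey by blast
      qed simp
    qed
  qed
  have "finite ?blind"
    by (rule finite_subset[OF _ finite_not_seen[OF c(2)]]) (use c(1) in \<open>auto simp: sees_def\<close>)
  then show "finite (?blind \<union> (\<Union>s \<in> ?blind. {y \<in> upds. sees s y}) \<union> {..x})"
    using finite_seen by simp
qed

section \<open>The history of the run\<close>

definition run_history :: "(nat, 'p tagged) history" where
  "run_history = \<lparr>events = snaps \<union> upds, op_of = oper,
     process_order = {(s, t). s \<in> snaps \<union> upds \<and> t \<in> snaps \<union> upds \<and> s \<le> t \<and> proc s = proc t}\<rparr>"

lemma events_invoked: "snaps \<union> upds \<subseteq> invoked E"
  using snapsD(1) updsD unfolding invoked_def updates_def by blast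

lemma run_history_consistent: "sequentially_consistent snapshot_spec run_history"
proof (rule sequentially_consistent_snapshotI[where f = sort_key])
  show "inj_on sort_key (events run_history)" unfolding sort_key_def by (auto intro: inj_onI)
  show "finite {e' \<in> events run_history. sort_key e' \<le> sort_key e}" if e: "e \<in> events run_history" for e
  proof (cases "finite (invoked E)")
    case True
    then show ?thesis using finite_subset[OF events_invoked] by (simp add: run_history_def)
  next
    case False
    then have "observable (proc e) e" if "e \<in> upds" using updsD[OF that] by blast
    then show ?thesis using e finite_past_snapshot finite_past_update by (auto simp: run_history_def)
  qed
  show "e \<in> events run_history \<and> e' \<in> events run_history \<and> sort_key e \<le> sort_key e'"
    if "(e, e') \<in> process_order run_history" for e e'
    using that sort_key_process_order by (auto simp: run_history_def)
  show "(a j = 0 \<and> (\<forall>x \<in> events run_history. \<forall>v. op_of run_history x = (j, Update v) \<longrightarrow>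
          \<not> sort_key x < sort_key e)) \<or>
      (\<exists>x \<in> events run_history. op_of run_history x = (j, Update (a j)) \<and> sort_key x < sort_key e \<and>
        (\<forall>y \<in> events run_history. \<forall>v. op_of run_history y = (j, Update v) \<longrightarrow>
           sort_key y < sort_key e \<longrightarrow> sort_key y \<le> sort_key x))"
    if e: "e \<in> events run_history" "op_of run_history e = (i, Snapshot a)" for e i a j
  proof -
    have ev: "events run_history = snaps \<union> upds" and op: "op_of run_history = oper"
      by (simp_all add: run_history_def)
    have upd: "y \<in> upds \<and> proc y = j" if "y \<in> snaps \<union> upds" "oper y = (j, Update v)" for y v
      using that snapsD(3) by fastforce
    have "e \<notin> upds" using updsD[of e] e(2) proc_update unfolding op by (metis oper.distinct(1) snd_conv)
    then have s: "e \<in> snaps" using e(1) unfolding ev by blast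
    have "(i, Snapshot a) = (proc e, Snapshot (l_X (L (returns e) (proc e))))"
      using snapsD(3)[OF s] e(2) unfolding op by metis
    then have "a = l_X (L (returns e) (proc e))" by blast
    then show ?thesis using snapshot_values[OF s, of j] upd unfolding ev op by (metis UnCI)
  qed
qed

lemma run_history_models: "models run_history E"
  unfolding models_def
proof (intro conjI ballI)
  show "events run_history \<subseteq> invoked E" using events_invoked by (simp add: run_history_def)
  show "returned E - crash_interrupted E \<subseteq> events run_history"
  proof
    fix t assume t: "t \<in> returned E - crash_interrupted E"
    then consider i v where "act E t = Do_Update i v" | "t \<in> snaps"
      unfolding returned_def snaps_def by blast
    then show "t \<in> events run_history"
    proof cases
      case 1
      then have "observable i t" using completed_update_observable t by blast
      then show ?thesis using 1 by (auto simp: run_history_def upds_def updates_def)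
    qed (simp add: run_history_def)
  qed
  show "appears_as E t (op_of run_history t)" if "t \<in> events run_history" for t
  proof (cases "t \<in> snaps")
    case True
    then obtain i a where a: "snapshot_result E t i a" unfolding snaps_def by blast
    note d = snapshot_resultD[OF a]
    have "op_of run_history t = (i, Snapshot a)" using d(1,5) by (simp add: run_history_def)
    then show ?thesis using a d(1) unfolding appears_as_def by blast
  next
    case False
    then have "t \<in> upds" using that by (simp add: run_history_def)
    then obtain v where "updates (proc t) v t" using updsD by blast
    then show ?thesis using proc_update[of "proc t" v t]
      unfolding appears_as_def updates_def by (auto simp: run_history_def)
  qed
  show "process_order run_history = {(s, t). s \<in> events run_history \<and> t \<in> events run_history \<and>
     s \<le> t \<and> fst (op_of run_history s) = fst (op_of run_history t)}"
    by (simp add: run_history_def)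
qed

lemma run_history_finite:
  assumes "finite (invoked E)"
  shows "returned E \<subseteq> events run_history"
  using assms by (auto simp: returned_def run_history_def snaps_def upds_def updates_def)

end

theorem proposition6:
  fixes E :: "'p::finite execution"
  assumes "admissible E"
  shows "\<exists>H. models H E \<and>
             (finite (invoked E) \<longrightarrow> returned E \<subseteq> events H) \<and>
             sequentially_consistent snapshot_spec H"
proof -
  obtain L S r where "run E L S r" using admissible_run[OF assms] .
  then interpret run E L S r .
  show ?thesis using run_history_models run_history_finite run_history_consistent by blast
qed

end
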